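(* Let $n\ge 1$. An element $g\in\mathrm{SU}(n)\ltimes\mathbb{C}^n$ is strongly reversible in $\mathrm{SU}(n)\ltimes\mathbb{C}^n$ if and only if the linear part of $g$ is strongly reversible in $\mathrm{SU}(n)$ and $g$ is not conjugate in $\mathrm{SU}(n)\ltimes\mathbb{C}^n$ to an element of the form $(A,v)$ with $$A=\mathrm{diag}(e^{i\theta_1},e^{-i\theta_1},\dots,e^{i\theta_{2r}},e^{-i\theta_{2r}},1),\qquad v=[0,0,\dots,0,v_1],$$ where $v_1\in\mathbb{C}$, $v_1\neq0$, $r\ge0$ is an integer (so that $n=4r+1$), and $\theta_k\in(0,\pi)$ for $k=1,\dots,2r$.
   Context: $\mathrm{SU}(n)$ is the group of complex unitary $n\times n$ matrices of determinant $1$. Elements of $\mathrm{SU}(n)\ltimes\mathbb{C}^n$ are pairs $(A,v)$ with $A\in\mathrm{SU}(n)$ (the linear part), $v\in\mathbb{C}^n$, acting as the affine maps $z\mapsto Az+v$ of $\mathbb{C}^n$; the group operation is composition. An element $g$ of a group $G$ is strongly reversible in $G$ if there is $h\in G$ with $h^2=1$ and $hgh^{-1}=g^{-1}$. When $r=0$ the displayed matrix is $A=(1)$ and $n=1$. *)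

theory Defs
  imports "HOL-Algebra.Group" "Jordan_Normal_Form.Schur_Decomposition"
begin

definition strongly_reversible :: "('a, 'b) monoid_scheme \<Rightarrow> 'a \<Rightarrow> bool" where
  "strongly_reversible G g \<longleftrightarrow>
    (\<exists>h \<in> carrier G. h \<otimes>\<^bsub>G\<^esub> h = \<one>\<^bsub>G\<^esub> \<and> h \<otimes>\<^bsub>G\<^esub> g \<otimes>\<^bsub>G\<^esub> inv\<^bsub>G\<^esub> h = inv\<^bsub>G\<^esub> g)"

definition conjugate_in :: "('a, 'b) monoid_scheme \<Rightarrow> 'a \<Rightarrow> 'a \<Rightarrow> bool" where
  "conjugate_in G x y \<longleftrightarrow> (\<exists>h \<in> carrier G. h \<otimes>\<^bsub>G\<^esub> x \<otimes>\<^bsub>G\<^esub> inv\<^bsub>G\<^esub> h = y)"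

definition SU :: "nat \<Rightarrow> complex mat monoid" where
  "SU n = \<lparr>carrier = {A \<in> carrier_mat n n. mat_adjoint A * A = 1\<^sub>m n \<and> det A = 1},
           monoid.mult = (*), one = 1\<^sub>m n\<rparr>"

definition SU_affine :: "nat \<Rightarrow> (complex mat \<times> complex vec) monoid" where
  "SU_affine n = \<lparr>carrier = carrier (SU n) \<times> carrier_vec n,
                  monoid.mult = (\<lambda>(A, v) (B, w). (A * B, A *\<^sub>v w + v)), one = (1\<^sub>m n, 0\<^sub>v n)\<rparr>"

definition affine_action :: "complex mat \<times> complex vec \<Rightarrow> complex vec \<Rightarrow> complex vec" where
  "affine_action g z = fst g *\<^sub>v z + snd g"

(* diag(e^(i theta_1), e^(-i theta_1), ..., e^(i theta_(2r)), e^(-i theta_(2r)), 1): matrix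
   positions are counted from 0, the angles from 1, so positions 2k - 2 and 2k - 1 carry theta_k. *)
definition paired_rotation_mat :: "nat \<Rightarrow> (nat \<Rightarrow> real) \<Rightarrow> complex mat" where
  "paired_rotation_mat r \<theta> = mat_diag (4 * r + 1)
     (\<lambda>i. if i = 4 * r then 1
          else if even i then cis (\<theta> (i div 2 + 1)) else cis (- \<theta> (i div 2 + 1)))"

definition last_coord_vec :: "nat \<Rightarrow> complex \<Rightarrow> complex vec" where
  "last_coord_vec r c = vec (4 * r + 1) (\<lambda>i. if i = 4 * r then c else 0)"


lemma mat_adjoint_carrier: "A \<in> carrier_mat n n \<Longrightarrow> mat_adjoint A \<in> carrier_mat n n"
  by (auto simp: mat_adjoint_def)

lemma mat_adjoint_index:
  assumes "A \<in> carrier_mat n m" "i < m" "j < n"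
  shows "mat_adjoint A $$ (i, j) = conjugate (A $$ (j, i))"
  using assms by (simp add: mat_adjoint_def mat_of_rows_index)

lemma mat_adjoint_mult:
  assumes A: "A \<in> carrier_mat n n" and B: "B \<in> carrier_mat n n"
  shows "mat_adjoint (A * B) = mat_adjoint B * mat_adjoint (A :: complex mat)"
proof (rule eq_matI)
  note c = mat_adjoint_carrier[OF A] mat_adjoint_carrier[OF B]
  fix i j
  assume "i < dim_row (mat_adjoint B * mat_adjoint A)" "j < dim_col (mat_adjoint B * mat_adjoint A)"
  with c have ij: "i < n" "j < n" by auto
  have "mat_adjoint (A * B) $$ (i, j) = cnj (\<Sum>k<n. A $$ (j, k) * B $$ (k, i))"
    using A B ij mult_carrier_mat[OF A B]
    by (simp add: mat_adjoint_index[of _ n n] scalar_prod_def atLeast0LessThan)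
  also have "\<dots> = (\<Sum>k<n. mat_adjoint B $$ (i, k) * mat_adjoint A $$ (k, j))"
    using A B ij by (simp add: mat_adjoint_index[of _ n n] mult.commute)
  also have "\<dots> = (mat_adjoint B * mat_adjoint A) $$ (i, j)"
    using c ij by (simp add: scalar_prod_def atLeast0LessThan)
  finally show "mat_adjoint (A * B) $$ (i, j) = (mat_adjoint B * mat_adjoint A) $$ (i, j)" .
qed (use A B in \<open>auto simp: mat_adjoint_def\<close>)

lemma mat_adjoint_adjoint:
  assumes A: "A \<in> carrier_mat n n"
  shows "mat_adjoint (mat_adjoint (A :: complex mat)) = A"
  using A mat_adjoint_carrier[OF A] mat_adjoint_carrier[OF mat_adjoint_carrier[OF A]]
  by (intro eq_matI) (auto simp: mat_adjoint_index[of _ n n])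

lemma mat_adjoint_one: "mat_adjoint (1\<^sub>m n) = (1\<^sub>m n :: complex mat)"
  using mat_adjoint_carrier[of "1\<^sub>m n :: complex mat" n]
  by (intro eq_matI) (auto simp: mat_adjoint_index[of _ n n])

lemma group_SU: "group (SU n)"
proof (rule groupI)
  fix x y assume "x \<in> carrier (SU n)" "y \<in> carrier (SU n)"
  then have x: "x \<in> carrier_mat n n" "mat_adjoint x * x = 1\<^sub>m n" "det x = 1"
    and y: "y \<in> carrier_mat n n" "mat_adjoint y * y = 1\<^sub>m n" "det y = 1"
    by (auto simp: SU_def)
  note c = mat_adjoint_carrier[OF x(1)] mat_adjoint_carrier[OF y(1)]
  have "mat_adjoint (x * y) * (x * y) = mat_adjoint y * ((mat_adjoint x * x) * y)"
    using x(1) y(1) c by (simp add: mat_adjoint_mult[of _ n] assoc_mult_mat[of _ n n _ n _ n])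
  then show "x \<otimes>\<^bsub>SU n\<^esub> y \<in> carrier (SU n)"
    using x y by (simp add: SU_def det_mult)
next
  show "\<one>\<^bsub>SU n\<^esub> \<in> carrier (SU n)" by (simp add: SU_def mat_adjoint_one)
next
  fix x assume "x \<in> carrier (SU n)"
  then have x: "x \<in> carrier_mat n n" "mat_adjoint x * x = 1\<^sub>m n" "det x = 1"
    by (auto simp: SU_def)
  note c = mat_adjoint_carrier[OF x(1)]
  have "x * mat_adjoint x = 1\<^sub>m n"
    by (rule mat_mult_left_right_inverse[OF c x(1,2)])
  moreover have "det (mat_adjoint x) = 1"
    using det_mult[OF c x(1)] x by simp
  ultimately have "mat_adjoint x \<in> carrier (SU n)"
    using c x(1) by (simp add: SU_def mat_adjoint_adjoint)
  then show "\<exists>y\<in>carrier (SU n). y \<otimes>\<^bsub>SU n\<^esub> x = \<one>\<^bsub>SU n\<^esub>"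
    using x(2) by (auto simp: SU_def)
qed (auto simp: SU_def)

lemma affine_assoc:
  assumes "A \<in> carrier_mat n n" "B \<in> carrier_mat n n"
    "u \<in> carrier_vec n" "v \<in> carrier_vec n" "w \<in> carrier_vec n"
  shows "A *\<^sub>v (B *\<^sub>v u) + (A *\<^sub>v v + w) = A *\<^sub>v (B *\<^sub>v u + v) + (w :: complex vec)"
proof -
  have c: "B *\<^sub>v u \<in> carrier_vec n" using assms by simp
  have "A *\<^sub>v (B *\<^sub>v u + v) + w = (A *\<^sub>v (B *\<^sub>v u) + A *\<^sub>v v) + w"
    using assms(1,4) c by (simp only: mult_add_distrib_mat_vec)
  also have "\<dots> = A *\<^sub>v (B *\<^sub>v u) + (A *\<^sub>v v + w)"
    using assms c by (intro assoc_add_vec[of _ n]) auto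
  finally show ?thesis by simp
qed

lemma group_SU_affine: "group (SU_affine n)"
proof -
  interpret S: group "SU n" by (rule group_SU)
  have car: "A \<in> carrier_mat n n" if "A \<in> carrier (SU n)" for A
    using that by (simp add: SU_def)
  have mul: "A * B \<in> carrier (SU n)" if "A \<in> carrier (SU n)" "B \<in> carrier (SU n)" for A B
    using S.m_closed[OF that] by (simp add: SU_def)
  show ?thesis
  proof (rule groupI)
    fix x y assume "x \<in> carrier (SU_affine n)" "y \<in> carrier (SU_affine n)"
    then show "x \<otimes>\<^bsub>SU_affine n\<^esub> y \<in> carrier (SU_affine n)"
      by (auto simp: SU_affine_def mul dest: car)
  next
    show "\<one>\<^bsub>SU_affine n\<^esub> \<in> carrier (SU_affine n)"
      using S.one_closed by (simp add: SU_affine_def) (simp add: SU_def mat_adjoint_one)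
  next
    fix x y z
    assume "x \<in> carrier (SU_affine n)" "y \<in> carrier (SU_affine n)" "z \<in> carrier (SU_affine n)"
    then show "x \<otimes>\<^bsub>SU_affine n\<^esub> y \<otimes>\<^bsub>SU_affine n\<^esub> z
               = x \<otimes>\<^bsub>SU_affine n\<^esub> (y \<otimes>\<^bsub>SU_affine n\<^esub> z)"
      by (auto simp: SU_affine_def affine_assoc[of _ n] dest!: car)
  next
    fix x assume "x \<in> carrier (SU_affine n)"
    then show "\<one>\<^bsub>SU_affine n\<^esub> \<otimes>\<^bsub>SU_affine n\<^esub> x = x"
      by (auto simp: SU_affine_def dest!: car)
  next
    fix x assume "x \<in> carrier (SU_affine n)"
    then obtain A v where x: "x = (A, v)" "A \<in> carrier (SU n)" "v \<in> carrier_vec n"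
      by (auto simp: SU_affine_def)
    obtain B where B: "B \<in> carrier (SU n)" "B * A = 1\<^sub>m n"
      using S.l_inv_ex[OF x(2)] by (auto simp: SU_def)
    have "(B, - (B *\<^sub>v v)) \<in> carrier (SU_affine n)"
      using B(1) x(3) car[OF B(1)] by (simp add: SU_affine_def)
    moreover have "(B, - (B *\<^sub>v v)) \<otimes>\<^bsub>SU_affine n\<^esub> x = \<one>\<^bsub>SU_affine n\<^esub>"
      using B x car[OF B(1)] by (simp add: SU_affine_def)
    ultimately show "\<exists>y\<in>carrier (SU_affine n). y \<otimes>\<^bsub>SU_affine n\<^esub> x = \<one>\<^bsub>SU_affine n\<^esub>"
      by blast
  qed
qed

lemma affine_action_mult:
  assumes "g \<in> carrier (SU_affine n)" "h \<in> carrier (SU_affine n)" "z \<in> carrier_vec n"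
  shows "affine_action (g \<otimes>\<^bsub>SU_affine n\<^esub> h) z = affine_action g (affine_action h z)"
  using assms by (auto simp: SU_affine_def SU_def affine_action_def affine_assoc[of _ n])

end

theory Submission
  imports Defs
begin

text \<open>
  An element is strongly reversible iff some involution \<open>h\<close> makes \<open>h g\<close> an involution too. Conjugating
  by a unitary matrix and a translation, \<open>g\<close> becomes \<open>(D, w)\<close> with \<open>D\<close> diagonal and \<open>w\<close> fixed by \<open>D\<close>;
  then \<open>(B, u)\<close> reverses \<open>g\<close> only if \<open>B w = - w\<close>. A reversing involution \<open>B\<close> swaps the eigenspaces
  of \<open>z\<close> and \<open>cnj z\<close> and is free on those of \<open>1\<close> and \<open>-1\<close>, so if \<open>w\<close> is nonzero, its determinant can be made
  \<open>1\<close> unless \<open>w\<close> spans all of the eigenspaces of \<open>1\<close> and \<open>-1\<close> together. In that case the trace of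
  \<open>B\<close> is \<open>-1\<close>, and a unitary involution of trace \<open>n - 2 k\<close> has determinant \<open>(-1)^k\<close>, which is \<open>-1\<close>
  exactly when \<open>n = 4 r + 1\<close>.
\<close>

section \<open>Unitary matrices\<close>

lemma mat_adjoint_dim [simp]:
  "dim_row (mat_adjoint A) = dim_col A" "dim_col (mat_adjoint A) = dim_row A"
  by (auto simp: mat_adjoint_def)

lemma mat_adjoint_index_dim [simp]:
  "i < dim_col A \<Longrightarrow> j < dim_row A \<Longrightarrow> mat_adjoint A $$ (i, j) = conjugate (A $$ (j, i))"
  using mat_adjoint_index[of A "dim_row A" "dim_col A" i j] by auto

text \<open>Diagonalization takes place among unitary matrices of any determinant;
  \<open>unitary_scale_SU\<close> normalizes the determinant afterwards.\<close>

definition unitary_mats :: "nat \<Rightarrow> complex mat set" where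
  "unitary_mats n = {U \<in> carrier_mat n n. mat_adjoint U * U = 1\<^sub>m n}"

lemma unitary_mats_carrier:
  "U \<in> unitary_mats n \<Longrightarrow> U \<in> carrier_mat n n"
  "U \<in> unitary_mats n \<Longrightarrow> mat_adjoint U \<in> carrier_mat n n"
  by (auto simp: unitary_mats_def mat_adjoint_carrier)

lemma unitary_mats_dim:
  "U \<in> unitary_mats n \<Longrightarrow> dim_row U = n"
  "U \<in> unitary_mats n \<Longrightarrow> dim_col U = n"
  by (auto simp: unitary_mats_def)

lemma unitary_mats_inverse:
  assumes "U \<in> unitary_mats n"
  shows "mat_adjoint U * U = 1\<^sub>m n" "U * mat_adjoint U = 1\<^sub>m n"
proof -
  show 1: "mat_adjoint U * U = 1\<^sub>m n" using assms by (simp add: unitary_mats_def)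
  show "U * mat_adjoint U = 1\<^sub>m n"
    by (rule mat_mult_left_right_inverse[OF _ _ 1]) (use assms unitary_mats_carrier in auto)
qed

lemma unitary_mats_adjoint:
  assumes "U \<in> unitary_mats n"
  shows "mat_adjoint U \<in> unitary_mats n"
  using unitary_mats_inverse(2)[OF assms] unitary_mats_carrier[OF assms]
  by (simp add: unitary_mats_def mat_adjoint_adjoint[of _ n])

lemma unitary_mats_mult:
  assumes "U \<in> unitary_mats n" "V \<in> unitary_mats n"
  shows "U * V \<in> unitary_mats n"
proof -
  note c = unitary_mats_carrier[OF assms(1)] unitary_mats_carrier[OF assms(2)]
  have "mat_adjoint (U * V) * (U * V) = mat_adjoint V * ((mat_adjoint U * U) * V)"
    using c by (simp add: mat_adjoint_mult[of _ n] assoc_mult_mat[of _ n n _ n _ n])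
  also have "\<dots> = 1\<^sub>m n"
    using c unitary_mats_inverse(1)[OF assms(1)] unitary_mats_inverse(1)[OF assms(2)]
    by simp
  finally show ?thesis
    using c by (simp add: unitary_mats_def)
qed

lemma carrier_SU_iff: "A \<in> carrier (SU n) \<longleftrightarrow> A \<in> unitary_mats n \<and> det A = 1"
  by (auto simp: SU_def unitary_mats_def)

lemma unitary_mats_iff_cols:
  "U \<in> unitary_mats n \<longleftrightarrow> U \<in> carrier_mat n n \<and>
     (\<forall>i<n. \<forall>j<n. (\<Sum>k<n. cnj (U $$ (k, i)) * U $$ (k, j)) = (if i = j then 1 else 0))"
proof (cases "U \<in> carrier_mat n n")
  case True
  have "(mat_adjoint U * U) $$ (i, j) = (\<Sum>k<n. cnj (U $$ (k, i)) * U $$ (k, j))"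
    if "i < n" "j < n" for i j
    using that True by (simp add: scalar_prod_def atLeast0LessThan)
  with True show ?thesis
    by (auto simp: unitary_mats_def mat_eq_iff)
qed (simp add: unitary_mats_def)

lemma unitary_mats_rows:
  assumes "U \<in> unitary_mats n" "i < n" "j < n"
  shows "(\<Sum>k<n. U $$ (i, k) * cnj (U $$ (j, k))) = (if i = j then 1 else 0)"
proof -
  have "(\<Sum>k<n. U $$ (i, k) * cnj (U $$ (j, k))) = (U * mat_adjoint U) $$ (i, j)"
    using assms unitary_mats_dim[OF assms(1)] by (simp add: scalar_prod_def atLeast0LessThan)
  then show ?thesis using assms by (simp add: unitary_mats_inverse)
qed

text \<open>The witness is a phase times the Householder reflection that swaps the vector with a phase
  multiple of the last basis vector; if the two coincide, division by zero makes it a scalar.\<close>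

lemma unitary_with_last_column:
  assumes x: "(\<Sum>i<Suc m. (cmod (x $ i))\<^sup>2) = 1"
  shows "\<exists>W \<in> unitary_mats (Suc m). \<forall>i<Suc m. W $$ (i, m) = x $ i"
proof -
  define \<rho> where "\<rho> = cmod (x $ m)"
  \<comment> \<open>The phase of the last entry makes the inner product of \<open>x\<close> with
    \<open>p\<close> times the last basis vector equal to the real number \<open>\<rho>\<close>, so
    that a reflection can exchange these two unit vectors. If the entry is 0, any phase
    does.\<close>
  define p where "p = (if x $ m = 0 then 1 else x $ m / \<rho>)"
  have p1: "cmod p = 1" by (auto simp: p_def \<rho>_def norm_divide)
  then have pc: "cnj p * p = 1" by (metis complex_norm_square mult.commute of_real_1 one_power2)
  have xm: "x $ m = \<rho> * p" by (auto simp: p_def \<rho>_def)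
  define u where "u i = x $ i - (if i = m then p else 0)" for i
  define N where "N = (\<Sum>i<Suc m. (cmod (u i))\<^sup>2)"
  have um: "u m = (\<rho> - 1) * p" by (simp add: u_def xm algebra_simps)
  have "(\<Sum>i<m. (cmod (u i))\<^sup>2) = (\<Sum>i<m. (cmod (x $ i))\<^sup>2)"
    by (intro sum.cong) (auto simp: u_def)
  moreover have "(cmod (u m))\<^sup>2 = (\<rho> - 1)\<^sup>2"
    unfolding um norm_mult p1 by (metis norm_of_real of_real_1 of_real_diff power2_abs mult_1_right)
  ultimately have N: "N = 2 - 2 * \<rho>"
    using x by (simp add: N_def \<rho>_def power2_eq_square algebra_simps)
  define t where "t = complex_of_real (2 / N)"
  \<comment> \<open>This holds for \<open>N = 0\<close> as well, where \<open>t = 0\<close>; it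
    cancels the linear terms of the Gram sums of \<open>W\<close> against the quadratic one.\<close>
  have t: "t * t * N = 2 * t" by (simp add: t_def)
  have Nc: "(\<Sum>k<Suc m. cnj (u k) * u k) = N"
    unfolding N_def of_real_sum by (intro sum.cong refl) (metis complex_norm_square mult.commute of_real_power)
  define W where "W = mat (Suc m) (Suc m) (\<lambda>(i, j). p * ((if i = j then 1 else 0) - t * u i * cnj (u j)))"
  have "(\<Sum>k<Suc m. cnj (W $$ (k, i)) * W $$ (k, j)) = (if i = j then 1 else 0)"
    if "i < Suc m" "j < Suc m" for i j
  proof -
    have tc: "cnj t = t" by (simp add: t_def)
    have "(\<Sum>k<Suc m. cnj (W $$ (k, i)) * W $$ (k, j)) =
       (\<Sum>k<Suc m. (cnj p * p) * ((if i = k then if k = j then 1 else 0 else 0)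
          - (if i = k then t * u k * cnj (u j) else 0) - (if j = k then t * cnj (u k) * u i else 0)
          + t * t * u i * cnj (u j) * (cnj (u k) * u k)))"
      using that by (intro sum.cong) (auto simp: W_def algebra_simps tc)
    also have "\<dots> = (if i = j then 1 else 0) - 2 * t * u i * cnj (u j) + (t * t * N) * u i * cnj (u j)"
      using that unfolding pc mult_1_left
      by (simp only: sum.distrib sum_subtractf sum_distrib_left[symmetric] Nc)
         (simp add: algebra_simps del: sum.lessThan_Suc)
    finally show ?thesis by (simp add: t)
  qed
  then have "W \<in> unitary_mats (Suc m)"
    unfolding unitary_mats_iff_cols by (simp add: W_def)
  moreover have "W $$ (i, m) = x $ i" if i: "i < Suc m" for i
  proof -
    have "W $$ (i, m) = (if i = m then p else 0) - t * u i * (\<rho> - 1) * (cnj p * p)"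
      using i by (auto simp: W_def um algebra_simps)
    also have "\<dots> = (if i = m then p else 0) - t * (\<rho> - 1) * u i" by (simp add: pc)
    also have "t * (\<rho> - 1) * u i = - u i"
    proof (cases "N = 0")
      case True
      then have "\<forall>k\<in>{..<Suc m}. (cmod (u k))\<^sup>2 = 0"
        unfolding N_def by (subst (asm) sum_nonneg_eq_0_iff) auto
      then show ?thesis using i by auto
    next
      case False
      then have "2 / N * (\<rho> - 1) = -1" using N by (simp add: field_simps)
      then have "t * (\<rho> - 1) = -1" unfolding t_def
        by (metis of_real_1 of_real_diff of_real_minus of_real_mult)
      then show ?thesis by simp
    qed
    finally show ?thesis by (simp add: u_def)
  qed
  ultimately show ?thesis by blast
qed

section \<open>Diagonalization of unitary matrices\<close>

lemma prod_list_map_upt: "(\<Prod>a\<leftarrow>map d [0..<n]. f a) = (\<Prod>i<n. f (d i) :: 'a :: comm_monoid_mult)"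
  by (induction n) (auto simp: mult.commute)

lemma prod_list_nth: "(\<Prod>a\<leftarrow>as. f a) = (\<Prod>i<length as. f (as ! i) :: 'a :: comm_monoid_mult)"
  using prod_list_map_upt[of f "(!) as" "length as"] by (simp only: map_nth)

lemma diag_mat_mat_diag: "diag_mat (mat_diag n d) = map d [0..<n]"
  by (auto simp: diag_mat_def mat_diag_def)

lemma upper_triangular_mat_diag: "upper_triangular (mat_diag n d)"
  by (auto simp: mat_diag_def upper_triangular_def)

lemma char_poly_mat_diag:
  "char_poly (mat_diag n d :: complex mat) = (\<Prod>i<n. [:- d i, 1:])"
  using char_poly_upper_triangular[OF mat_diag_dim upper_triangular_mat_diag, of n d]
  by (simp only: diag_mat_mat_diag prod_list_map_upt)

lemma det_mat_diag: "det (mat_diag n d :: complex mat) = (\<Prod>i<n. d i)"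
  using det_upper_triangular[OF upper_triangular_mat_diag mat_diag_dim, of n d]
    prod_list_map_upt[of "\<lambda>a. a" d n]
  by (simp add: diag_mat_mat_diag)

lemma mat_adjoint_mat_diag:
  "mat_adjoint (mat_diag n d) = mat_diag n (\<lambda>i. cnj (d i))"
  by (rule eq_matI) (auto simp: mat_diag_def)

lemma similar_mat_unitary_conj:
  assumes "U \<in> unitary_mats n" "A \<in> carrier_mat n n"
  shows "similar_mat (mat_adjoint U * A * U) A"
  unfolding similar_mat_def
  by (intro exI, rule similar_mat_witI[of "mat_adjoint U" U n])
     (use assms unitary_mats_carrier[OF assms(1)] unitary_mats_inverse[OF assms(1)] in auto)

lemma unitary_mats_conj:
  assumes "U \<in> unitary_mats n" "A \<in> unitary_mats n"
  shows "mat_adjoint U * A * U \<in> unitary_mats n"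
  using assms by (intro unitary_mats_mult unitary_mats_adjoint)

lemma unitary_four_block:
  assumes "V \<in> unitary_mats m"
  shows "four_block_mat V (0\<^sub>m m 1) (0\<^sub>m 1 m) (1\<^sub>m 1) \<in> unitary_mats (Suc m)" (is "?F \<in> _")
    and "mat_adjoint (four_block_mat V (0\<^sub>m m 1) (0\<^sub>m 1 m) (1\<^sub>m 1))
      = four_block_mat (mat_adjoint V) (0\<^sub>m m 1) (0\<^sub>m 1 m) (1\<^sub>m 1)"
proof -
  note c = unitary_mats_carrier[OF assms]
  show ad: "mat_adjoint ?F = four_block_mat (mat_adjoint V) (0\<^sub>m m 1) (0\<^sub>m 1 m) (1\<^sub>m 1)"
    using c by (intro eq_matI) (auto simp: four_block_mat_def)
  have "mat_adjoint ?F * ?F = 1\<^sub>m (Suc m)"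
    unfolding ad using c unitary_mats_inverse(1)[OF assms]
    by (simp add: mult_four_block_mat[of _ m m _ 1 _ 1 _ _ m _ 1] left_add_zero_mat[of _ m m])
  moreover have "?F \<in> carrier_mat (Suc m) (Suc m)"
    using four_block_carrier_mat[OF c(1) one_carrier_mat[of 1]] by simp
  ultimately show "?F \<in> unitary_mats (Suc m)" by (simp add: unitary_mats_def)
qed

text \<open>Deflation: in an orthonormal basis ending in \<open>x\<close>, \<open>A\<close> becomes
  block diagonal with last entry \<open>d m\<close>, and the smaller block is unitary with the
  remaining spectrum. The induction hypothesis is an assumption and the last column is recorded, so
  that \<open>conjugate_to_last_coordinate\<close> can prescribe the eigenvector.\<close>

lemma unitary_diagonalization_step:
  assumes IH: "\<And>B. B \<in> unitary_mats m \<Longrightarrow> char_poly B = (\<Prod>i<m. [:- d i, 1:]) \<Longrightarrow>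
      \<exists>V \<in> unitary_mats m. mat_adjoint V * B * V = mat_diag m d"
    and A: "A \<in> unitary_mats (Suc m)"
    and cp: "char_poly A = (\<Prod>i<Suc m. [:- d i, 1:])"
    and x: "x \<in> carrier_vec (Suc m)" "(\<Sum>i<Suc m. (cmod (x $ i))\<^sup>2) = 1"
    and ev: "A *\<^sub>v x = d m \<cdot>\<^sub>v x"
  shows "\<exists>U \<in> unitary_mats (Suc m). mat_adjoint U * A * U = mat_diag (Suc m) d \<and> col U m = x"
proof -
  let ?n = "Suc m"
  obtain W where W: "W \<in> unitary_mats ?n" and Wx: "\<And>i. i < ?n \<Longrightarrow> W $$ (i, m) = x $ i"
    using unitary_with_last_column[OF x(2)] by blast
  note c = unitary_mats_carrier[OF W] unitary_mats_carrier[OF A]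
  have colW: "col W m = x" using c x Wx by (intro eq_vecI) auto
  define M where "M = mat_adjoint W * A * W"
  have M: "M \<in> unitary_mats ?n" unfolding M_def using W A by (rule unitary_mats_conj)
  have Mc: "M \<in> carrier_mat ?n ?n" using M by (rule unitary_mats_carrier)
  have "col M m = mat_adjoint W *\<^sub>v (A *\<^sub>v col W m)"
    unfolding M_def assoc_mult_mat[OF c(2,3,1)] col_mult2[OF c(2) mult_carrier_mat[OF c(3,1)] lessI]
      col_mult2[OF c(3,1) lessI] ..
  also have "\<dots> = d m \<cdot>\<^sub>v (mat_adjoint W *\<^sub>v col W m)"
    unfolding colW ev using c x by (simp add: mult_mat_vec[of _ ?n ?n])
  also have "mat_adjoint W *\<^sub>v col W m = col (mat_adjoint W * W) m"
    unfolding col_mult2[OF c(2,1) lessI] ..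
  also have "\<dots> = unit_vec ?n m" by (simp add: unitary_mats_inverse(1)[OF W])
  finally have colM: "col M m = d m \<cdot>\<^sub>v unit_vec ?n m" .
  have Mim: "M $$ (i, m) = (if i = m then d m else 0)" if "i < ?n" for i
    using that Mc arg_cong[OF colM, of "\<lambda>v. v $ i"] by (auto simp: unit_vec_def)
  have "(\<Sum>k<?n. cnj (M $$ (k, m)) * M $$ (k, m)) = 1"
    using M unfolding unitary_mats_iff_cols by simp
  then have dm: "cnj (d m) * d m = 1" by (simp add: Mim)
  \<comment> \<open>The last row has norm 1 and \<open>d m\<close> already uses all of it, so the
    other entries of that row vanish.\<close>
  have "(\<Sum>k<?n. M $$ (m, k) * cnj (M $$ (m, k))) = 1"
    using unitary_mats_rows[OF M, of m m] by simp
  then have "(\<Sum>k<m. M $$ (m, k) * cnj (M $$ (m, k))) = 0"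
    using dm by (simp add: Mim mult.commute)
  then have "(\<Sum>k<m. complex_of_real ((cmod (M $$ (m, k)))\<^sup>2)) = 0"
    by (simp only: complex_norm_square)
  then have "(\<Sum>k<m. (cmod (M $$ (m, k)))\<^sup>2) = 0"
    unfolding of_real_sum[symmetric] of_real_eq_0_iff .
  then have Mmj: "M $$ (m, j) = 0" if "j < m" for j
    using that by (subst (asm) sum_nonneg_eq_0_iff) auto
  define B where "B = mat m m (\<lambda>(i, j). M $$ (i, j))"
  have Bc: "B \<in> carrier_mat m m" by (simp add: B_def)
  let ?D = "mat 1 1 (\<lambda>_. d m)"
  have MB: "M = four_block_mat B (0\<^sub>m m 1) (0\<^sub>m 1 m) ?D"
    using Mc Mim Mmj by (intro eq_matI) (auto simp: B_def four_block_mat_def less_Suc_eq)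
  have B: "B \<in> unitary_mats m"
    unfolding unitary_mats_iff_cols
  proof (intro conjI Bc allI impI)
    fix i j assume "i < m" "j < m"
    then have "(\<Sum>k<m. cnj (B $$ (k, i)) * B $$ (k, j)) = (\<Sum>k<?n. cnj (M $$ (k, i)) * M $$ (k, j))"
      by (simp add: B_def Mmj)
    also have "\<dots> = (if i = j then 1 else 0)"
      using M \<open>i < m\<close> \<open>j < m\<close> unfolding unitary_mats_iff_cols by simp
    finally show "(\<Sum>k<m. cnj (B $$ (k, i)) * B $$ (k, j)) = (if i = j then 1 else 0)" .
  qed
  \<comment> \<open>\<open>char_poly_0_block\<close> asks for characteristic polynomials that split,
    which is automatic over the complex numbers.\<close>
  have linear: "\<exists>es. char_poly C = (\<Prod>a\<leftarrow>es. [:- a, 1:])" if "C \<in> carrier_mat k k"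
    for C :: "complex mat" and k
    using char_poly_factorized[OF that] by blast
  have "char_poly A = char_poly M"
    unfolding M_def using char_poly_similar[OF similar_mat_unitary_conj[OF W c(3)]] by simp
  also have "\<dots> = char_poly B * char_poly ?D"
    using Bc by (intro char_poly_0_block[OF MB] linear[of _ m] linear[of _ 1]) auto
  also have "?D = mat_diag 1 (\<lambda>_. d m)" by (auto simp: mat_diag_def)
  also have "char_poly \<dots> = [:- d m, 1:]" unfolding char_poly_mat_diag by simp
  finally have "char_poly B * [:- d m, 1:] = (\<Prod>i<m. [:- d i, 1:]) * [:- d m, 1:]"
    using cp by simp
  then have "char_poly B = (\<Prod>i<m. [:- d i, 1:])"
    by (metis mult_right_cancel one_neq_zero pCons_eq_0_iff)
  then obtain V where V: "V \<in> unitary_mats m" and VB: "mat_adjoint V * B * V = mat_diag m d"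
    using IH[OF B] by blast
  note cV = unitary_mats_carrier[OF V]
  define F where "F = four_block_mat V (0\<^sub>m m 1) (0\<^sub>m 1 m) (1\<^sub>m 1)"
  have F: "F \<in> unitary_mats ?n" unfolding F_def using V by (rule unitary_four_block)
  note cF = unitary_mats_carrier[OF F]
  have "mat_adjoint F * M * F = four_block_mat (mat_adjoint V * B * V) (0\<^sub>m m 1) (0\<^sub>m 1 m) ?D"
    unfolding F_def MB unitary_four_block(2)[OF V] using cV Bc
    by (simp add: mult_four_block_mat[of _ m m _ 1 _ 1 _ _ m _ 1])
  also have "\<dots> = mat_diag ?n d"
    unfolding VB by (intro eq_matI) (auto simp: mat_diag_def four_block_mat_def less_Suc_eq)
  finally have "mat_adjoint (W * F) * A * (W * F) = mat_diag ?n d"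
    using c cF by (simp add: M_def mat_adjoint_mult[of _ ?n] assoc_mult_mat[of _ ?n ?n _ ?n _ ?n])
  moreover have "col (W * F) m = x"
  proof -
    \<comment> \<open>The padded block fixes the last basis vector, so the last column of
      \<open>W\<close> survives.\<close>
    have "col F m = unit_vec ?n m"
      using cV by (intro eq_vecI) (auto simp: F_def four_block_mat_def unit_vec_def)
    then have "col (W * F) m = W *\<^sub>v unit_vec ?n m"
      unfolding col_mult2[OF c(1) cF(1) lessI] by simp
    also have "\<dots> = col W m" using c by (intro eq_vecI) auto
    finally show ?thesis using colW by simp
  qed
  moreover have "W * F \<in> unitary_mats ?n" using W F by (rule unitary_mats_mult)
  ultimately show ?thesis by blast
qed

lemma vec_normalize:
  assumes "v \<in> carrier_vec n" "v \<noteq> 0\<^sub>v n"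
  obtains c :: complex where "c \<noteq> 0" "(\<Sum>i<n. (cmod ((c \<cdot>\<^sub>v v) $ i))\<^sup>2) = 1"
proof -
  define N where "N = (\<Sum>i<n. (cmod (v $ i))\<^sup>2)"
  obtain i where "i < n" "v $ i \<noteq> 0" using assms by (auto simp: vec_eq_iff)
  then have N: "N > 0" unfolding N_def by (intro sum_pos2[of _ i]) auto
  have "(\<Sum>i<n. (cmod ((complex_of_real (1 / sqrt N) \<cdot>\<^sub>v v) $ i))\<^sup>2) = (\<Sum>i<n. (cmod (v $ i))\<^sup>2 / N)"
    using assms N by (intro sum.cong) (auto simp: norm_mult norm_divide power_divide)
  also have "\<dots> = 1" using N by (simp add: sum_divide_distrib[symmetric] N_def[symmetric])
  finally show ?thesis using N by (intro that[of "complex_of_real (1 / sqrt N)"]) auto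
qed

text \<open>Every enumeration \<open>d\<close> of the spectrum is allowed, so the order of the
  eigenvalues on the diagonal can be prescribed. Each induction step peels off the last one.\<close>

lemma unitary_diagonalization:
  assumes "A \<in> unitary_mats n" "char_poly A = (\<Prod>i<n. [:- d i, 1:])"
  shows "\<exists>U \<in> unitary_mats n. mat_adjoint U * A * U = mat_diag n d"
  using assms
proof (induction n arbitrary: A)
  case 0
  then show ?case by (intro bexI[of _ A]) (auto simp: unitary_mats_def mat_diag_def)
next
  case (Suc m)
  note c = unitary_mats_carrier[OF Suc.prems(1)]
  have "poly (char_poly A) (d m) = 0" unfolding Suc.prems by simp
  then have "eigenvalue A (d m)" using eigenvalue_root_char_poly[OF c(1)] by simp
  then obtain v where v: "v \<in> carrier_vec (Suc m)" "v \<noteq> 0\<^sub>v (Suc m)" "A *\<^sub>v v = d m \<cdot>\<^sub>v v"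
    using c by (auto simp: eigenvalue_def eigenvector_def)
  from v(1,2) obtain k where k: "(\<Sum>i<Suc m. (cmod ((k \<cdot>\<^sub>v v) $ i))\<^sup>2) = 1"
    by (rule vec_normalize)
  have "A *\<^sub>v (k \<cdot>\<^sub>v v) = d m \<cdot>\<^sub>v (k \<cdot>\<^sub>v v)"
    using c v by (simp add: mult_mat_vec[of _ "Suc m" "Suc m"] smult_smult_assoc mult.commute)
  from unitary_diagonalization_step[OF Suc.IH Suc.prems smult_carrier_vec[THEN iffD2, OF v(1)] k this]
  show ?case by blast
qed

lemma trace_mult_commute:
  assumes "X \<in> carrier_mat n m" "Y \<in> carrier_mat m n"
  shows "(\<Sum>i<n. (X * Y) $$ (i, i)) = (\<Sum>j<m. (Y * X) $$ (j, j) :: complex)"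
proof -
  have "(\<Sum>i<n. (X * Y) $$ (i, i)) = (\<Sum>i<n. \<Sum>j<m. X $$ (i, j) * Y $$ (j, i))"
    using assms by (intro sum.cong) (auto simp: scalar_prod_def atLeast0LessThan)
  also have "\<dots> = (\<Sum>j<m. \<Sum>i<n. Y $$ (j, i) * X $$ (i, j))"
    by (subst sum.swap) (simp add: mult.commute)
  also have "\<dots> = (\<Sum>j<m. (Y * X) $$ (j, j))"
    using assms by (intro sum.cong) (auto simp: scalar_prod_def atLeast0LessThan)
  finally show ?thesis .
qed

lemma mat_diag_eq_iff: "mat_diag n d = mat_diag n e \<longleftrightarrow> (\<forall>i<n. d i = e i)"
  by (auto simp: mat_diag_def mat_eq_iff)

lemma unitary_diagonal:
  assumes "A \<in> unitary_mats n"
  obtains as U where "length as = n" "char_poly A = (\<Prod>a\<leftarrow>as. [:- a, 1:])"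
    "U \<in> unitary_mats n" "mat_adjoint U * A * U = mat_diag n ((!) as)"
    "\<And>a. a \<in> set as \<Longrightarrow> cmod a = 1"
proof -
  obtain as where as: "char_poly A = (\<Prod>a\<leftarrow>as. [:- a, 1:])" "length as = n"
    using char_poly_factorized[OF unitary_mats_carrier(1)[OF assms]] by blast
  then obtain U where U: "U \<in> unitary_mats n" "mat_adjoint U * A * U = mat_diag n ((!) as)"
    using unitary_diagonalization[OF assms, of "(!) as"] by (auto simp: prod_list_nth)
  have "mat_diag n ((!) as) \<in> unitary_mats n"
    unfolding U(2)[symmetric] using U(1) assms by (rule unitary_mats_conj)
  then have "mat_diag n (\<lambda>i. cnj (as ! i) * as ! i) = mat_diag n (\<lambda>_. 1)"
    by (simp add: unitary_mats_def mat_adjoint_mat_diag)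
  then have "cnj (as ! i) * as ! i = 1" if "i < n" for i
    using that unfolding mat_diag_eq_iff by simp
  then have "cmod a = 1" if "a \<in> set as" for a
    using that as(2) unfolding in_set_conv_nth
    by (metis complex_mod_cnj mult.commute norm_mult norm_one real_sqrt_abs2 real_sqrt_one abs_norm_cancel)
  with as U that show ?thesis by blast
qed

lemma cmod_det_unitary:
  assumes "U \<in> unitary_mats n"
  shows "cmod (det U) = 1"
proof -
  obtain as V where V: "V \<in> unitary_mats n" "mat_adjoint V * U * V = mat_diag n ((!) as)"
    "length as = n" "\<And>a. a \<in> set as \<Longrightarrow> cmod a = 1"
    using unitary_diagonal[OF assms] by metis
  have "cmod (det U) = cmod (det (mat_diag n ((!) as)))"
    using det_similar[OF similar_mat_unitary_conj[OF V(1) unitary_mats_carrier(1)[OF assms]]] V(2)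
    by simp
  also have "\<dots> = (\<Prod>i<n. cmod (as ! i))" unfolding det_mat_diag by (simp only: prod_norm)
  also have "\<dots> = 1" using V(3,4) by (intro prod.neutral) auto
  finally show ?thesis .
qed

text \<open>The eigenvalues are 1 and -1, and the trace counts how many of them are -1. The
  determinant of an involution can thus be found from its diagonal entries alone.\<close>

lemma unitary_involution_det:
  assumes B: "B \<in> unitary_mats n" "B * B = 1\<^sub>m n"
    and tr: "(\<Sum>i<n. B $$ (i, i)) = of_int (int n - 2 * int k)"
  shows "det B = (-1) ^ k"
proof -
  obtain as U where U: "U \<in> unitary_mats n" "mat_adjoint U * B * U = mat_diag n ((!) as)"
    using unitary_diagonal[OF B(1)] by metis
  define d where "d = (!) as"
  note c = unitary_mats_carrier[OF U(1)] unitary_mats_carrier[OF B(1)]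
  note assoc = assoc_mult_mat[of _ n n _ n _ n]
  have "(mat_adjoint U * B * U) * (mat_adjoint U * B * U)
      = mat_adjoint U * (B * ((U * mat_adjoint U) * (B * U)))"
    using c by (simp add: assoc)
  also have "\<dots> = mat_adjoint U * ((B * B) * U)"
    using c by (simp add: unitary_mats_inverse[OF U(1)] assoc)
  also have "\<dots> = mat_diag n (\<lambda>_. 1)"
    using c by (simp add: unitary_mats_inverse[OF U(1)] B(2))
  finally have "mat_diag n (\<lambda>i. d i * d i) = mat_diag n (\<lambda>_. 1)"
    unfolding U(2) by (simp add: d_def)
  then have d: "d i = 1 \<or> d i = -1" if "i < n" for i
    using that unfolding mat_diag_eq_iff by (metis square_eq_1_iff)
  define K where "K = {i \<in> {..<n}. d i = -1}"
  have dK: "d i = (if i \<in> K then -1 else 1)" if "i < n" for i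
    using d[OF that] that by (auto simp: K_def)
  have KS: "{..<n} \<inter> K = K" by (auto simp: K_def)
  have "(\<Sum>i<n. B $$ (i, i)) = (\<Sum>i<n. (B * (U * mat_adjoint U)) $$ (i, i))"
    using c by (simp add: unitary_mats_inverse[OF U(1)])
  also have "\<dots> = (\<Sum>i<n. (mat_adjoint U * (B * U)) $$ (i, i))"
    using c trace_mult_commute[of "B * U" n n "mat_adjoint U"] by (simp add: assoc)
  also have "\<dots> = (\<Sum>i<n. d i)"
    using c U(2) by (simp add: assoc mat_diag_def d_def)
  also have "\<dots> = (\<Sum>i<n. 1 - 2 * (if i \<in> K then 1 else 0))"
    by (intro sum.cong) (auto simp: dK)
  also have "\<dots> = of_int (int n - 2 * int (card K))"
    by (simp add: sum_subtractf sum_distrib_left[symmetric] sum.If_cases KS)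
  finally have "card K = k" using tr by (simp del: of_int_diff)
  have "det B = det (mat_diag n d)"
    using det_similar[OF similar_mat_unitary_conj[OF U(1) c(3)]] U(2) by (simp add: d_def)
  also have "\<dots> = (\<Prod>i<n. if i \<in> K then -1 else 1)"
    unfolding det_mat_diag by (intro prod.cong) (auto simp: dK)
  also have "\<dots> = (-1) ^ k" using \<open>card K = k\<close> by (simp add: prod.If_cases KS)
  finally show ?thesis .
qed

section \<open>Spectra of reversible matrices\<close>

lemma proots_linear_factors: "proots (\<Prod>a\<leftarrow>as. [:- a, 1 :: complex:]) = mset as"
proof (induction as)
  case (Cons a as)
  have "(\<Prod>a\<leftarrow>as. [:- a, 1 :: complex:]) \<noteq> 0" by (auto simp: prod_list_zero_iff)
  with Cons show ?case by (simp add: proots_mult del: mult_pCons_left)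
qed simp

text \<open>The involution \<open>B\<close> conjugates \<open>A\<close> into its inverse, which is
  its adjoint and has the conjugate eigenvalues. Equal characteristic polynomials have equal
  multisets of roots.\<close>

lemma spectrum_of_reversible:
  assumes A: "A \<in> unitary_mats n" and B: "B \<in> carrier_mat n n" "B * B = 1\<^sub>m n"
    and BA: "B * A * (B * A) = 1\<^sub>m n"
  obtains as where "length as = n" "char_poly A = (\<Prod>a\<leftarrow>as. [:- a, 1:])"
    "mset (map cnj as) = mset as" "\<And>a. a \<in> set as \<Longrightarrow> cmod a = 1"
proof -
  obtain as U where as: "length as = n" "char_poly A = (\<Prod>a\<leftarrow>as. [:- a, 1:])"
    "\<And>a. a \<in> set as \<Longrightarrow> cmod a = 1"
    and U: "U \<in> unitary_mats n" "mat_adjoint U * A * U = mat_diag n ((!) as)"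
    using unitary_diagonal[OF A] by metis
  note c = unitary_mats_carrier[OF U(1)] unitary_mats_carrier[OF A] B(1)
  note assoc = assoc_mult_mat[of _ n n _ n _ n]
  have "mat_adjoint A = (B * A * (B * A)) * mat_adjoint A" using c by (simp add: BA)
  also have "\<dots> = B * A * B * (A * mat_adjoint A)" using c by (simp add: assoc)
  finally have A': "mat_adjoint A = B * A * B" using c by (simp add: unitary_mats_inverse[OF A])
  have "similar_mat (mat_adjoint A) A"
    unfolding similar_mat_def A'
    by (intro exI, rule similar_mat_witI[of B B n]) (use c B in auto)
  then have "char_poly A = char_poly (mat_adjoint A)" by (simp add: char_poly_similar)
  also have "\<dots> = char_poly (mat_adjoint U * mat_adjoint A * U)"
    using char_poly_similar[OF similar_mat_unitary_conj[OF U(1) c(4)]] by simp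
  also have "mat_adjoint U * mat_adjoint A * U = mat_adjoint (mat_adjoint U * A * U)"
    using c by (simp add: mat_adjoint_mult[of _ n] mat_adjoint_adjoint[of _ n] assoc)
  also have "char_poly \<dots> = (\<Prod>a\<leftarrow>map cnj as. [:- a, 1:])"
    unfolding U(2) mat_adjoint_mat_diag char_poly_mat_diag
    by (subst prod_list_nth) (simp add: as(1))
  finally have "proots (\<Prod>a\<leftarrow>as. [:- a, 1:]) = proots (\<Prod>a\<leftarrow>map cnj as. [:- a, 1:])"
    unfolding as(2) by (rule arg_cong)
  then have "mset (map cnj as) = mset as" unfolding proots_linear_factors by simp
  with as that show ?thesis by blast
qed

text \<open>The eigenvalues 1 come last, so that the last coordinate can carry a translation fixed
  by the diagonal matrix. For an even number of pairs, no -1 and a single 1 this is the diagonal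
  pattern of \<open>paired_rotation_mat\<close>.\<close>

definition paired_values :: "complex list \<Rightarrow> nat \<Rightarrow> nat \<Rightarrow> complex" where
  "paired_values zs a i =
    (if i < 2 * length zs then if even i then zs ! (i div 2) else cnj (zs ! (i div 2))
     else if i < 2 * length zs + a then -1 else 1)"

lemma prod_lessThan_add:
  "(\<Prod>i<k + l :: nat. f i :: 'a :: comm_monoid_mult) = (\<Prod>i<k. f i) * (\<Prod>i<l. f (k + i))"
  by (induction l) (auto simp: mult.assoc)

lemma prod_lessThan_double:
  "(\<Prod>i<2 * s :: nat. f i) = (\<Prod>k<s. f (2 * k)) * (\<Prod>k<s. f (2 * k + 1) :: 'a :: comm_monoid_mult)"
  by (induction s) (auto simp: mult_ac)

text \<open>On the unit circle only 1 and -1 are real, and conjugation matches the values above the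
  real axis with those below, multiplicities included. In the last conclusion the \<open>a\<close>
  bound by the left product is not the count \<open>a\<close> on the right.\<close>

lemma conj_closed_order:
  assumes sym: "mset (map cnj as) = mset as" and unit: "\<And>a. a \<in> set as \<Longrightarrow> cmod a = 1"
  obtains zs a m where "length as = 2 * length zs + a + m"
    "\<And>z. z \<in> set zs \<Longrightarrow> cmod z = 1 \<and> Im z > 0"
    "(\<Prod>a\<leftarrow>as. [:- a, 1:]) = (\<Prod>i<length as. [:- paired_values zs a i, 1:])"
proof -
  define M where "M = mset as"
  define P where "P = filter_mset (\<lambda>z. Im z > 0) M"
  obtain zs where zs: "mset zs = P" using ex_mset by blast
  define a m where "a = count M (-1)" and "m = count M 1"
  have M1: "cmod z = 1" if "z \<in># M" for z using that unit by (auto simp: M_def)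
  have "image_mset cnj M = M" using sym by (simp add: M_def)
  then have N: "filter_mset (\<lambda>z. Im z < 0) M = image_mset cnj P"
    using filter_mset_image_mset[of "\<lambda>z. Im z < 0" cnj M] by (simp add: P_def)
  have real: "z = 1 \<or> z = -1" if "z \<in># M" "Im z = 0" for z
  proof -
    have "\<bar>Re z\<bar> = 1" using M1[OF that(1)] that(2) by (simp add: cmod_eq_Re)
    then show ?thesis using that(2) by (auto simp: complex_eq_iff abs_if split: if_splits)
  qed
  have "M = P + filter_mset (\<lambda>z. Im z < 0) M + filter_mset (\<lambda>z. z = -1) M + filter_mset (\<lambda>z. z = 1) M"
    (is "_ = ?R")
  proof (rule multiset_eqI)
    fix z show "count M z = count ?R z"
    proof (cases "z \<in># M")
      case True
      then show ?thesis using real[of z] by (cases "Im z > 0"; cases "Im z < 0") (auto simp: P_def)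
    qed (auto simp: P_def not_in_iff)
  qed
  then have M: "M = mset zs + image_mset cnj (mset zs) + replicate_mset a (-1) + replicate_mset m 1"
    unfolding N zs filter_eq_replicate_mset a_def m_def .
  have len: "length as = 2 * length zs + a + m"
    using arg_cong[OF M, of size] by (simp add: M_def)
  have "(\<Prod>a\<leftarrow>as. [:- a, 1:]) = prod_mset (image_mset (\<lambda>a. [:- a, 1:]) M)"
    by (simp add: M_def flip: prod_mset_prod_list)
  also have "\<dots> = (\<Prod>z\<leftarrow>zs. [:- z, 1:]) * (\<Prod>z\<leftarrow>zs. [:- cnj z, 1:]) * [:1, 1:] ^ a * [:- 1, 1:] ^ m"
    unfolding M by (simp add: image_mset.compositionality comp_def flip: prod_mset_prod_list)
  also have "\<dots> = (\<Prod>i<length as. [:- paired_values zs a i, 1:])"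
    unfolding len prod_lessThan_add prod_lessThan_double
    by (simp add: prod_list_nth paired_values_def)
  finally have prod: "(\<Prod>a\<leftarrow>as. [:- a, 1:]) = (\<Prod>i<length as. [:- paired_values zs a i, 1:])" .
  have "cmod z = 1 \<and> Im z > 0" if "z \<in> set zs" for z
  proof -
    have "z \<in># P" using that by (simp flip: zs)
    then show ?thesis using M1 by (simp add: P_def)
  qed
  from that[OF len this prod] show ?thesis .
qed

section \<open>Conjugation and reversal in the affine group\<close>

context group
begin

text \<open>An involution is its own inverse, so the reversing condition turns into an equation
  without inverses, which can be read off in coordinates.\<close>

lemma strongly_reversible_iff_involutions:
  assumes "g \<in> carrier G"
  shows "strongly_reversible G g \<longleftrightarrow>
    (\<exists>h \<in> carrier G. h \<otimes> h = \<one> \<and> (h \<otimes> g) \<otimes> (h \<otimes> g) = \<one>)"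
proof -
  have "h \<otimes> g \<otimes> inv h = inv g \<longleftrightarrow> (h \<otimes> g) \<otimes> (h \<otimes> g) = \<one>"
    if h: "h \<in> carrier G" "h \<otimes> h = \<one>" for h
  proof -
    have "inv h = h" using h by (simp add: inv_equality)
    moreover have "h \<otimes> g \<otimes> h = inv g \<longleftrightarrow> (h \<otimes> g \<otimes> h) \<otimes> g = \<one>"
      using h assms by (metis inv_equality l_inv m_closed)
    ultimately show ?thesis using h assms by (simp add: m_assoc)
  qed
  then show ?thesis unfolding strongly_reversible_def by blast
qed

lemma conjugate_in_iff:
  assumes "x \<in> carrier G" "y \<in> carrier G"
  shows "conjugate_in G x y \<longleftrightarrow> (\<exists>h \<in> carrier G. h \<otimes> x = y \<otimes> h)"
proof -
  have "h \<otimes> x \<otimes> inv h = y \<longleftrightarrow> h \<otimes> x = y \<otimes> h" if "h \<in> carrier G" for h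
    using that assms inv_solve_right[of y "h \<otimes> x" h] by auto
  then show ?thesis unfolding conjugate_in_def by blast
qed

lemma conjugate_in_closed:
  "conjugate_in G x y \<Longrightarrow> x \<in> carrier G \<Longrightarrow> y \<in> carrier G"
  by (auto simp: conjugate_in_def)

lemma conjugate_in_sym:
  assumes "conjugate_in G x y" "x \<in> carrier G"
  shows "conjugate_in G y x"
proof -
  have y: "y \<in> carrier G" using assms by (rule conjugate_in_closed)
  obtain h where h: "h \<in> carrier G" "h \<otimes> x = y \<otimes> h"
    using assms y by (auto simp: conjugate_in_iff)
  then have "inv h \<otimes> y \<otimes> h = x"
    using assms(2) y by (simp add: m_assoc flip: h(2)) (simp add: m_assoc[symmetric])
  then show ?thesis using h(1) unfolding conjugate_in_def by (metis inv_closed inv_inv)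
qed

lemma conjugate_in_trans:
  assumes "conjugate_in G x y" "conjugate_in G y z" "x \<in> carrier G"
  shows "conjugate_in G x z"
proof -
  have yz: "y \<in> carrier G" "z \<in> carrier G" using assms conjugate_in_closed by blast+
  obtain h k where h: "h \<in> carrier G" "h \<otimes> x = y \<otimes> h" and k: "k \<in> carrier G" "k \<otimes> y = z \<otimes> k"
    using assms yz by (auto simp: conjugate_in_iff)
  have "(k \<otimes> h) \<otimes> x = z \<otimes> (k \<otimes> h)"
    using h k assms(3) yz by (metis m_assoc)
  with h k show ?thesis using assms(3) yz by (auto simp: conjugate_in_iff)
qed

lemma strongly_reversible_conjugate:
  assumes "conjugate_in G x y" "x \<in> carrier G" "strongly_reversible G x"
  shows "strongly_reversible G y"
proof -
  obtain k where k: "k \<in> carrier G" and y: "y = k \<otimes> x \<otimes> inv k"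
    using assms(1) by (auto simp: conjugate_in_def)
  obtain h where h: "h \<in> carrier G" "h \<otimes> h = \<one>" "(h \<otimes> x) \<otimes> (h \<otimes> x) = \<one>"
    using assms by (auto simp: strongly_reversible_iff_involutions)
  have cancel: "inv k \<otimes> (k \<otimes> b) = b" if "b \<in> carrier G" for b
    using that k by (simp add: m_assoc[symmetric])
  have conj: "(k \<otimes> a \<otimes> inv k) \<otimes> (k \<otimes> b \<otimes> inv k) = k \<otimes> (a \<otimes> b) \<otimes> inv k"
    if "a \<in> carrier G" "b \<in> carrier G" for a b
    using that k by (simp add: m_assoc cancel)
  have "k \<otimes> h \<otimes> inv k \<otimes> (k \<otimes> h \<otimes> inv k) = \<one>"
    using h k by (simp only: conj) simp
  moreover have "(k \<otimes> h \<otimes> inv k \<otimes> y) \<otimes> (k \<otimes> h \<otimes> inv k \<otimes> y) = \<one>"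
    unfolding y using h k assms(2) by (simp only: conj m_closed) simp
  ultimately show ?thesis
    using h(1) k assms(2) y by (subst strongly_reversible_iff_involutions) (auto intro!: bexI[of _ "k \<otimes> h \<otimes> inv k"])
qed

end

section \<open>Reversal and conjugation as matrix equations\<close>

lemma SU_simps [simp]:
  "monoid.mult (SU n) = (*)" "one (SU n) = 1\<^sub>m n"
  by (simp_all add: SU_def)

lemma SU_affine_simps [simp]:
  "carrier (SU_affine n) = carrier (SU n) \<times> carrier_vec n"
  "(A, v) \<otimes>\<^bsub>SU_affine n\<^esub> (B, w) = (A * B, A *\<^sub>v w + v)"
  "one (SU_affine n) = (1\<^sub>m n, 0\<^sub>v n)"
  by (simp_all add: SU_affine_def)

lemma carrier_SU_mat: "A \<in> carrier (SU n) \<Longrightarrow> A \<in> carrier_mat n n"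
  by (simp add: SU_def)

lemma strongly_reversible_SU_iff:
  assumes "A \<in> carrier (SU n)"
  shows "strongly_reversible (SU n) A \<longleftrightarrow>
    (\<exists>B \<in> carrier (SU n). B * B = 1\<^sub>m n \<and> B * A * (B * A) = 1\<^sub>m n)"
  using group.strongly_reversible_iff_involutions[OF group_SU assms] by simp

text \<open>With h = \<open>(B, w)\<close> and g = \<open>(A, v)\<close>, the first two equations
  are the linear part and the translation of h h = 1, the last two those of (h g)(h g) = 1.\<close>

lemma strongly_reversible_SU_affine_iff:
  assumes "A \<in> carrier (SU n)" "v \<in> carrier_vec n"
  shows "strongly_reversible (SU_affine n) (A, v) \<longleftrightarrow>
    (\<exists>B \<in> carrier (SU n). \<exists>w \<in> carrier_vec n. B * B = 1\<^sub>m n \<and> B *\<^sub>v w + w = 0\<^sub>v n \<and>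
       B * A * (B * A) = 1\<^sub>m n \<and> (B * A) *\<^sub>v (B *\<^sub>v v + w) + (B *\<^sub>v v + w) = 0\<^sub>v n)"
proof -
  have "(A, v) \<in> carrier (SU_affine n)" using assms by simp
  from group.strongly_reversible_iff_involutions[OF group_SU_affine this]
  show ?thesis by (auto simp: Bex_def)
qed

lemma conjugate_in_SU_affine_iff:
  assumes "A \<in> carrier (SU n)" "v \<in> carrier_vec n" "A' \<in> carrier (SU n)" "v' \<in> carrier_vec n"
  shows "conjugate_in (SU_affine n) (A, v) (A', v') \<longleftrightarrow>
    (\<exists>V \<in> carrier (SU n). \<exists>w \<in> carrier_vec n. V * A = A' * V \<and> V *\<^sub>v v + w = A' *\<^sub>v w + v')"
proof -
  have "(A, v) \<in> carrier (SU_affine n)" "(A', v') \<in> carrier (SU_affine n)" using assms by simp_all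
  from group.conjugate_in_iff[OF group_SU_affine this]
  show ?thesis by (auto simp: Bex_def)
qed

lemma conjugate_in_SU_linear_part:
  assumes "A \<in> carrier (SU n)" "v \<in> carrier_vec n" "A' \<in> carrier (SU n)" "v' \<in> carrier_vec n"
    and "conjugate_in (SU_affine n) (A, v) (A', v')"
  shows "conjugate_in (SU n) A A'"
  using assms(5) unfolding conjugate_in_SU_affine_iff[OF assms(1-4)]
    group.conjugate_in_iff[OF group_SU assms(1,3)] by auto

section \<open>Normal forms up to conjugation\<close>

lemma mat_adjoint_smult: "mat_adjoint (k \<cdot>\<^sub>m A) = cnj k \<cdot>\<^sub>m mat_adjoint A"
  by (rule eq_matI) auto

lemma smult_mat_mult_vec:
  assumes "A \<in> carrier_mat n m" "v \<in> carrier_vec m"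
  shows "(k \<cdot>\<^sub>m A) *\<^sub>v v = k \<cdot>\<^sub>v (A *\<^sub>v v)"
  using assms by (intro eq_vecI) (auto simp: scalar_prod_def sum_distrib_left mult.assoc)

text \<open>A scalar of modulus 1 drops out of a conjugation but can correct the determinant: an
  n-th root of the inverse of \<open>det U\<close> does so.\<close>

lemma unitary_scale_SU:
  assumes U: "U \<in> unitary_mats n" and n: "n \<ge> 1"
  obtains k where "cmod k = 1" "k \<cdot>\<^sub>m U \<in> carrier (SU n)"
    "\<And>A. A \<in> carrier_mat n n \<Longrightarrow> mat_adjoint (k \<cdot>\<^sub>m U) * A * (k \<cdot>\<^sub>m U) = mat_adjoint U * A * U"
proof -
  note c = unitary_mats_carrier[OF U]
  define k where "k = cis (- Arg (det U) / real n)"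
  have k1: "cmod k = 1" by (simp add: k_def)
  then have kk: "cnj k * k = 1" by (metis complex_norm_square mult.commute of_real_1 one_power2)
  have conj: "mat_adjoint (k \<cdot>\<^sub>m U) * A * (k \<cdot>\<^sub>m U) = mat_adjoint U * A * U"
    if "A \<in> carrier_mat n n" for A
    using that c kk
    by (simp add: mat_adjoint_smult mult_smult_assoc_mat[of _ n n _ n] mult_smult_distrib[of _ n n _ n])
       (auto simp: mult.commute intro!: eq_matI)
  have "k ^ n = cis (- Arg (det U))" using n by (simp add: k_def DeMoivre)
  moreover have "det U = cis (Arg (det U))"
    using cmod_det_unitary[OF U] rcis_cmod_Arg[of "det U"] by (simp add: rcis_def)
  ultimately have "k ^ n * det U = 1" by (metis add.left_inverse cis_mult cis_zero)
  then have "det (k \<cdot>\<^sub>m U) = 1" using c by simp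
  moreover have "k \<cdot>\<^sub>m U \<in> unitary_mats n"
    using conj[of "1\<^sub>m n"] c unitary_mats_inverse(1)[OF U] by (simp add: unitary_mats_def mat_adjoint_carrier)
  ultimately show ?thesis using k1 conj that by (simp add: carrier_SU_iff)
qed

lemma SU_adjoint: "U \<in> carrier (SU n) \<Longrightarrow> mat_adjoint U \<in> carrier (SU n)"
  using unitary_mats_inverse(1)[of U n] det_mult[of "mat_adjoint U" n U]
  by (auto simp: carrier_SU_iff unitary_mats_adjoint unitary_mats_carrier)

lemma SU_conj:
  assumes U: "U \<in> carrier (SU n)" and A: "A \<in> carrier (SU n)"
  shows "mat_adjoint U * A * U \<in> carrier (SU n)"
    and "mat_adjoint U * A = (mat_adjoint U * A * U) * mat_adjoint U"
proof -
  show "mat_adjoint U * A * U \<in> carrier (SU n)"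
    using group.is_monoid[OF group_SU, of n] monoid.m_closed[of "SU n"] SU_adjoint[OF U] U A
    by (metis SU_simps(1))
  have U': "U \<in> unitary_mats n" using U by (simp add: carrier_SU_iff)
  show "mat_adjoint U * A = (mat_adjoint U * A * U) * mat_adjoint U"
    using unitary_mats_carrier[OF U'] carrier_SU_mat[OF A] unitary_mats_inverse[OF U']
    by (simp add: assoc_mult_mat[of _ n n _ n _ n])
qed

text \<open>After diagonalizing the linear part, conjugation by a translation clears the coordinates
  with \<open>d i\<close> different from 1, because the diagonal matrix minus the identity is
  invertible there.\<close>

lemma conjugate_to_diagonal:
  assumes A: "A \<in> carrier (SU n)" and v: "v \<in> carrier_vec n" and n: "n \<ge> 1"
    and cp: "char_poly A = (\<Prod>i<n. [:- d i, 1:])"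
  obtains w where "mat_diag n d \<in> carrier (SU n)" "w \<in> carrier_vec n"
    "\<And>i. i < n \<Longrightarrow> d i \<noteq> 1 \<Longrightarrow> w $ i = 0"
    "conjugate_in (SU_affine n) (A, v) (mat_diag n d, w)"
proof -
  have A': "A \<in> unitary_mats n" using A by (simp add: carrier_SU_iff)
  obtain U0 where U0: "U0 \<in> unitary_mats n" "mat_adjoint U0 * A * U0 = mat_diag n d"
    using unitary_diagonalization[OF A' cp] by blast
  obtain k where U: "k \<cdot>\<^sub>m U0 \<in> carrier (SU n)"
    "mat_adjoint (k \<cdot>\<^sub>m U0) * A * (k \<cdot>\<^sub>m U0) = mat_diag n d"
    using unitary_scale_SU[OF U0(1) n] carrier_SU_mat[OF A] U0(2) by metis
  define V where "V = mat_adjoint (k \<cdot>\<^sub>m U0)"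
  have V: "V \<in> carrier (SU n)" "V * A = mat_diag n d * V"
    using SU_adjoint[OF U(1)] SU_conj(2)[OF U(1) A] unfolding U(2) by (simp_all add: V_def)
  have D: "mat_diag n d \<in> carrier (SU n)" using SU_conj(1)[OF U(1) A] unfolding U(2) .
  define y where "y = V *\<^sub>v v"
  have y: "y \<in> carrier_vec n" using carrier_SU_mat[OF V(1)] v by (simp add: y_def)
  \<comment> \<open>With D the diagonal matrix, \<open>u\<close> solves D u - u = y on the
    coordinates where \<open>d i\<close> is not 1; \<open>w\<close> is the part of \<open>y\<close>
    that remains.\<close>
  define u where "u = vec n (\<lambda>i. if d i = 1 then 0 else y $ i / (d i - 1))"
  define w where "w = vec n (\<lambda>i. if d i = 1 then y $ i else 0)"
  have Du: "(mat_diag n d *\<^sub>v u) $ i = d i * u $ i" if "i < n" for i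
    using that by (simp add: mat_diag_def scalar_prod_def u_def if_distrib[of "\<lambda>x. x * _"] cong: if_cong)
  have "y + u = mat_diag n d *\<^sub>v u + w"
    using y Du by (intro eq_vecI) (auto simp: u_def w_def mat_diag_def field_simps)
  moreover have uw: "u \<in> carrier_vec n" "w \<in> carrier_vec n" by (simp_all add: u_def w_def)
  ultimately have "conjugate_in (SU_affine n) (A, v) (mat_diag n d, w)"
    unfolding conjugate_in_SU_affine_iff[OF A v D uw(2)] y_def using V by blast
  with D uw(2) show ?thesis by (intro that[of w]) (auto simp: w_def)
qed

lemma mat_diag_mult_vec:
  "v \<in> carrier_vec n \<Longrightarrow> mat_diag n d *\<^sub>v v = vec n (\<lambda>i. d i * v $ i :: complex)"
  by (rule eq_vecI)
     (auto simp: mat_diag_def scalar_prod_def if_distrib[of "\<lambda>x. x * _"] cong: if_cong)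

text \<open>The vector \<open>w\<close> is an eigenvector of the diagonal matrix for the eigenvalue
  1. Diagonalizing that matrix again, with the normalized \<open>w\<close> as last column, gives a
  unitary matrix that commutes with it and whose adjoint takes \<open>w\<close> to a multiple of the
  last basis vector.\<close>

lemma conjugate_to_last_coordinate:
  assumes D: "mat_diag (Suc m) d \<in> carrier (SU (Suc m))" and w: "w \<in> carrier_vec (Suc m)"
    and w0: "w \<noteq> 0\<^sub>v (Suc m)" and wd: "\<And>i. i < Suc m \<Longrightarrow> d i \<noteq> 1 \<Longrightarrow> w $ i = 0" and dm: "d m = 1"
  obtains c where "c \<noteq> 0"
    "conjugate_in (SU_affine (Suc m)) (mat_diag (Suc m) d, w) (mat_diag (Suc m) d, c \<cdot>\<^sub>v unit_vec (Suc m) m)"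
proof -
  let ?n = "Suc m" and ?D = "mat_diag (Suc m) d"
  have D': "?D \<in> unitary_mats ?n" using D by (simp add: carrier_SU_iff)
  obtain k where k: "k \<noteq> 0" "(\<Sum>i<?n. (cmod ((k \<cdot>\<^sub>v w) $ i))\<^sup>2) = 1"
    using vec_normalize[OF w w0] .
  have "?D *\<^sub>v (k \<cdot>\<^sub>v w) = d m \<cdot>\<^sub>v (k \<cdot>\<^sub>v w)"
  proof (rule eq_vecI)
    fix i assume "i < dim_vec (d m \<cdot>\<^sub>v (k \<cdot>\<^sub>v w))"
    then show "(?D *\<^sub>v (k \<cdot>\<^sub>v w)) $ i = (d m \<cdot>\<^sub>v (k \<cdot>\<^sub>v w)) $ i"
      using w wd[of i] by (cases "d i = 1") (auto simp: mat_diag_mult_vec dm)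
  qed (use w in \<open>auto simp: mat_diag_def\<close>)
  \<comment> \<open>\<open>unitary_diagonalization\<close> itself discharges the induction
    hypothesis of the step.\<close>
  from unitary_diagonalization_step[OF unitary_diagonalization D' char_poly_mat_diag _ k(2) this] w
  obtain U0 where U0: "U0 \<in> unitary_mats ?n" "mat_adjoint U0 * ?D * U0 = ?D" "col U0 m = k \<cdot>\<^sub>v w"
    by auto
  obtain j where j: "cmod j = 1" and U: "j \<cdot>\<^sub>m U0 \<in> carrier (SU ?n)"
    "mat_adjoint (j \<cdot>\<^sub>m U0) * ?D * (j \<cdot>\<^sub>m U0) = ?D"
    using unitary_scale_SU[OF U0(1)] carrier_SU_mat[OF D] U0(2) by (metis One_nat_def le_add1 plus_1_eq_Suc)
  define V where "V = mat_adjoint (j \<cdot>\<^sub>m U0)"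
  have V: "V \<in> carrier (SU ?n)" "V * ?D = ?D * V"
    using SU_adjoint[OF U(1)] SU_conj(2)[OF U(1) D] unfolding U(2) by (simp_all add: V_def)
  note c = unitary_mats_carrier[OF U0(1)]
  have "mat_adjoint U0 *\<^sub>v (k \<cdot>\<^sub>v w) = col (mat_adjoint U0 * U0) m"
    unfolding col_mult2[OF c(2,1) lessI] U0(3) ..
  also have "\<dots> = unit_vec ?n m" by (simp add: unitary_mats_inverse[OF U0(1)])
  finally have "k \<cdot>\<^sub>v (mat_adjoint U0 *\<^sub>v w) = unit_vec ?n m"
    using c w by (simp add: mult_mat_vec[of _ ?n ?n])
  then have "(1 / k) \<cdot>\<^sub>v (k \<cdot>\<^sub>v (mat_adjoint U0 *\<^sub>v w)) = (1 / k) \<cdot>\<^sub>v unit_vec ?n m" by simp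
  then have "mat_adjoint U0 *\<^sub>v w = (1 / k) \<cdot>\<^sub>v unit_vec ?n m"
    using k(1) by (simp add: smult_smult_assoc)
  then have "V *\<^sub>v w = (cnj j / k) \<cdot>\<^sub>v unit_vec ?n m"
    using c w by (simp add: V_def mat_adjoint_smult smult_mat_mult_vec[of _ ?n ?n] smult_smult_assoc)
  then have "conjugate_in (SU_affine ?n) (?D, w) (?D, (cnj j / k) \<cdot>\<^sub>v unit_vec ?n m)"
    using V D w by (subst conjugate_in_SU_affine_iff)
      (auto intro!: bexI[of _ V] bexI[of _ "0\<^sub>v ?n"] eq_vecI simp: mat_diag_mult_vec)
  moreover have "cnj j / k \<noteq> 0" using j k(1) by auto
  ultimately show ?thesis using that by blast
qed

section \<open>The reversing involution and the exceptional case\<close>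

text \<open>The witness is a signed permutation matrix: exchanging the members of each conjugate
  pair reverses the diagonal matrix, and on the eigenvalues 1 and -1 a sign can be chosen
  freely.\<close>

lemma paired_reversing_involution:
  fixes zs :: "complex list" and a m :: nat
  defines "s \<equiv> length zs" and "n \<equiv> 2 * length zs + a + Suc m"
  assumes zs: "\<And>z. z \<in> set zs \<Longrightarrow> cmod z = 1"
    and room: "a + m \<ge> 1 \<or> odd s"
  obtains B where "B \<in> carrier (SU n)" "B * B = 1\<^sub>m n"
    "B * mat_diag n (paired_values zs a) * (B * mat_diag n (paired_values zs a)) = 1\<^sub>m n"
    "B *\<^sub>v unit_vec n (n - 1) = - unit_vec n (n - 1)"
proof -
  define d where "d = paired_values zs a"
  define \<sigma> where "\<sigma> i = (if i < 2 * s then if even i then i + 1 else i - 1 else i)" for i :: nat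
  \<comment> \<open>The sign at \<open>n - 1\<close> negates the last basis vector. For even
    \<open>s\<close> a second sign at \<open>2 * s\<close> corrects the determinant, and
    \<open>room\<close> keeps the two positions apart.\<close>
  define \<beta> where "\<beta> i = (if i = n - 1 \<or> even s \<and> i = 2 * s then -1 else 1 :: complex)" for i
  have n: "n = 2 * s + a + Suc m" by (simp add: n_def s_def)
  have \<sigma>lt: "\<sigma> i < n" if "i < n" for i
    using that n unfolding \<sigma>_def by (auto elim!: evenE)
  have \<sigma>\<sigma>: "\<sigma> (\<sigma> i) = i" for i unfolding \<sigma>_def by (auto elim!: evenE oddE)
  have \<sigma>fix: "\<sigma> i = i \<longleftrightarrow> \<not> i < 2 * s" for i unfolding \<sigma>_def by (auto elim!: oddE)
  have \<sigma>ge: "\<sigma> i < 2 * s \<longleftrightarrow> i < 2 * s" for i unfolding \<sigma>_def by (auto elim!: evenE oddE)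
  have \<beta>\<sigma>: "\<beta> (\<sigma> i) = \<beta> i" for i
    using \<sigma>ge[of i] \<sigma>fix[of i] n by (cases "i < 2 * s") (auto simp: \<beta>_def)
  have \<beta>\<beta>: "\<beta> i * \<beta> i = 1" for i by (simp add: \<beta>_def)
  have zz: "zs ! j * cnj (zs ! j) = 1" if "j < s" for j
    using zs[of "zs ! j"] that unfolding s_def complex_norm_square[symmetric] by simp
  have d\<sigma>: "d (\<sigma> i) * d i = 1" if "i < n" for i
    using zz[of "i div 2"] that
    by (auto simp: d_def paired_values_def \<sigma>_def s_def[symmetric] mult.commute elim!: evenE oddE)
  define B where "B = mat n n (\<lambda>(i, j). if j = \<sigma> i then \<beta> i else 0)"
  have Bc: "B \<in> carrier_mat n n" by (simp add: B_def)
  have BC: "B * C = mat n n (\<lambda>(i, j). \<beta> i * C $$ (\<sigma> i, j))" if "C \<in> carrier_mat n n" for C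
    using that \<sigma>lt
    by (intro eq_matI) (auto simp: B_def scalar_prod_def if_distrib[of "\<lambda>x. x * _"] cong: if_cong)
  have BB: "B * B = 1\<^sub>m n"
    unfolding BC[OF Bc] using \<sigma>lt \<sigma>\<sigma> \<beta>\<sigma> \<beta>\<beta> by (intro eq_matI) (auto simp: B_def)
  have "mat_adjoint B = B"
    using \<sigma>\<sigma> \<beta>\<sigma> by (intro eq_matI) (auto simp: B_def \<beta>_def)
  with BB Bc have Bu: "B \<in> unitary_mats n" by (simp add: unitary_mats_def)
  let ?D = "mat_diag n d"
  have BD: "B * ?D = mat n n (\<lambda>(i, j). if j = \<sigma> i then \<beta> i * d j else 0)"
    using \<sigma>lt unfolding BC[OF mat_diag_dim] by (intro eq_matI) (auto simp: mat_diag_def)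
  have "B * ?D * (B * ?D) = B * (?D * (B * ?D))"
    using Bc by (simp add: assoc_mult_mat[of _ n n _ n _ n])
  also have "\<dots> = mat n n (\<lambda>(i, j). \<beta> i * (d (\<sigma> i) * (B * ?D) $$ (\<sigma> i, j)))"
    using Bc \<sigma>lt by (subst BC) (auto simp: mat_diag_mult_left[of _ n n] intro!: eq_matI)
  also have "\<dots> = 1\<^sub>m n"
  proof (rule eq_matI)
    fix i j assume "i < dim_row (1\<^sub>m n :: complex mat)" "j < dim_col (1\<^sub>m n :: complex mat)"
    then have ij: "i < n" "j < n" by auto
    have "\<beta> i * (d (\<sigma> i) * (\<beta> i * d i)) = (\<beta> i * \<beta> i) * (d (\<sigma> i) * d i)" by (simp add: mult_ac)
    then have "\<beta> i * (d (\<sigma> i) * (\<beta> i * d i)) = 1" using \<beta>\<beta> d\<sigma> ij by simp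
    then show "mat n n (\<lambda>(i, j). \<beta> i * (d (\<sigma> i) * (B * ?D) $$ (\<sigma> i, j))) $$ (i, j) = 1\<^sub>m n $$ (i, j)"
      using ij \<sigma>lt by (auto simp: BD \<sigma>\<sigma> \<beta>\<sigma>)
  qed auto
  finally have BDBD: "B * ?D * (B * ?D) = 1\<^sub>m n" .
  \<comment> \<open>Exchanged coordinates contribute 0 to the trace, the others their sign.\<close>
  have "(\<Sum>i<n. B $$ (i, i))
      = (\<Sum>i<n. 1 - (if i < 2 * s then 1 else 0) - (if i = n - 1 then 2 else 0)
              - (if i = 2 * s then if even s then 2 else 0 else 0))"
  proof (intro sum.cong refl)
    fix i assume "i \<in> {..<n}"
    then have Bii: "B $$ (i, i) = (if i < 2 * s then 0 else \<beta> i)"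
      using \<sigma>fix[of i] by (auto simp: B_def)
    have last: "\<not> n - 1 < 2 * s" "even s \<Longrightarrow> n - 1 \<noteq> 2 * s" using n room by auto
    show "B $$ (i, i) = 1 - (if i < 2 * s then 1 else 0) - (if i = n - 1 then 2 else 0)
              - (if i = 2 * s then if even s then 2 else 0 else 0)"
    proof (cases "i < 2 * s")
      case True
      with last(1) have "i \<noteq> n - 1" "i \<noteq> 2 * s" by auto
      with True show ?thesis by (simp add: Bii)
    next
      case False
      then have Bi: "B $$ (i, i) = \<beta> i" by (simp add: Bii)
      show ?thesis unfolding Bi \<beta>_def using False last(2) by auto
    qed
  qed
  also have "\<dots> = of_nat n - of_nat (2 * s) - 2 - (if even s then 2 else 0)"
  proof -
    have "{..<n} \<inter> {i. i < 2 * s} = {..<2 * s}" using n by auto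
    then have "(\<Sum>i<n. if i < 2 * s then 1 else 0 :: complex) = of_nat (2 * s)"
      by (simp add: sum.If_cases)
    then show ?thesis using n by (simp add: sum_subtractf)
  qed
  \<comment> \<open>The eigenvalue -1 occurs once per exchange and once per sign:
    \<open>s + 1\<close> times for odd \<open>s\<close> and \<open>s + 2\<close> times for even
    \<open>s\<close>, an even number either way.\<close>
  also have "\<dots> = of_int (int n - 2 * int (s + 1 + (if even s then 1 else 0)))" by simp
  finally have "det B = (-1) ^ (s + 1 + (if even s then 1 else 0))"
    by (rule unitary_involution_det[OF Bu BB])
  then have "det B = 1" by simp
  with Bu have "B \<in> carrier (SU n)" by (simp add: carrier_SU_iff)
  moreover have "B *\<^sub>v unit_vec n (n - 1) = - unit_vec n (n - 1)"
  proof (rule eq_vecI)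
    fix i assume "i < dim_vec (- unit_vec n (n - 1) :: complex vec)"
    then have i: "i < n" by simp
    have "n - 1 = \<sigma> i \<longleftrightarrow> i = n - 1" using \<sigma>\<sigma>[of i] \<sigma>fix[of "n - 1"] n by auto
    moreover have "(B *\<^sub>v unit_vec n (n - 1)) $ i = B $$ (i, n - 1)" using i n Bc by simp
    ultimately show "(B *\<^sub>v unit_vec n (n - 1)) $ i = (- unit_vec n (n - 1)) $ i"
      using i n by (simp add: B_def \<beta>_def)
  qed (simp add: B_def)
  ultimately show ?thesis using BB BDBD that unfolding d_def by blast
qed

section \<open>Obstruction for the exceptional family\<close>

lemma mult_mat_zero_vec:
  "A \<in> carrier_mat n m \<Longrightarrow> A *\<^sub>v 0\<^sub>v m = 0\<^sub>v n"
  by (intro eq_vecI) auto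

text \<open>For a diagonal \<open>D\<close> this equation says that an entry of \<open>B\<close> can
  be nonzero only where the two diagonal values multiply to 1.\<close>

lemma involution_reversed:
  fixes B D :: "complex mat"
  assumes B: "B \<in> carrier_mat n n" and D: "D \<in> carrier_mat n n"
    and BB: "B * B = 1\<^sub>m n" and BDBD: "B * D * (B * D) = 1\<^sub>m n"
  shows "B = D * (B * D)"
proof -
  have "B = B * (B * D * (B * D))" using B by (simp add: BDBD)
  also have "\<dots> = (B * B) * (D * (B * D))"
    using B D by (simp add: assoc_mult_mat[of _ n n _ n _ n])
  finally show ?thesis using B D by (simp add: BB)
qed

text \<open>Only the last diagonal entry of a reversing \<open>B\<close> can be nonzero, and the
  translation forces it to be -1. So \<open>B\<close> has trace -1, and in dimension 4r + 1 its
  eigenvalue -1 has the odd multiplicity 2r + 1, contrary to determinant 1.\<close>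

lemma not_reversible_exceptional:
  assumes \<theta>: "\<And>k. k \<in> {1..2 * r} \<Longrightarrow> \<theta> k \<in> {0<..<pi}" and c: "c \<noteq> 0"
    and D: "paired_rotation_mat r \<theta> \<in> carrier (SU (4 * r + 1))"
  shows "\<not> strongly_reversible (SU_affine (4 * r + 1)) (paired_rotation_mat r \<theta>, last_coord_vec r c)"
proof
  let ?n = "4 * r + 1" and ?l = "4 * r"
  define d where "d i = (if i = 4 * r then 1
          else if even i then cis (\<theta> (i div 2 + 1)) else cis (- \<theta> (i div 2 + 1)))" for i
  let ?D = "mat_diag ?n d" and ?v = "last_coord_vec r c"
  have Dd: "paired_rotation_mat r \<theta> = ?D" by (simp add: paired_rotation_mat_def mat_diag_eq_iff d_def)
  have vc: "?v \<in> carrier_vec ?n" by (simp add: last_coord_vec_def)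
  \<comment> \<open>The angles lie strictly between 0 and pi, so these values are not real and their
    squares cannot be 1.\<close>
  have d2: "d i * d i \<noteq> 1" "d i \<noteq> 1" if "i < 4 * r" for i
  proof -
    have "\<theta> (i div 2 + 1) \<in> {0<..<pi}" using that by (intro \<theta>) auto
    then have "sin (\<theta> (i div 2 + 1)) > 0" by (intro sin_gt_zero) auto
    moreover have "\<bar>Im (d i)\<bar> = \<bar>sin (\<theta> (i div 2 + 1))\<bar>" using that by (auto simp: d_def)
    ultimately have "Im (d i) \<noteq> 0" by auto
    then show "d i * d i \<noteq> 1" "d i \<noteq> 1" by (auto simp: square_eq_1_iff)
  qed
  assume "strongly_reversible (SU_affine ?n) (paired_rotation_mat r \<theta>, ?v)"
  then obtain B w where B: "B \<in> carrier (SU ?n)" "B * B = 1\<^sub>m ?n" and w: "w \<in> carrier_vec ?n"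
      "B *\<^sub>v w + w = 0\<^sub>v ?n" and BDBD: "B * ?D * (B * ?D) = 1\<^sub>m ?n"
      and Bv: "(B * ?D) *\<^sub>v (B *\<^sub>v ?v + w) + (B *\<^sub>v ?v + w) = 0\<^sub>v ?n"
    unfolding Dd strongly_reversible_SU_affine_iff[OF D[unfolded Dd] vc] by blast
  have Bc: "B \<in> carrier_mat ?n ?n" using B(1) by (rule carrier_SU_mat)
  have BDij: "B $$ (i, j) = d i * (B $$ (i, j) * d j)" if "i < ?n" "j < ?n" for i j
  proof -
    have "B $$ (i, j) = (?D * (B * ?D)) $$ (i, j)"
      using involution_reversed[OF Bc mat_diag_dim B(2) BDBD] by (rule arg_cong)
    also have "\<dots> = d i * (B $$ (i, j) * d j)"
      by (subst mat_diag_mult_left[OF mult_carrier_mat[OF Bc mat_diag_dim]],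
          subst mat_diag_mult_right[OF Bc]) (use that in simp)
    finally show ?thesis .
  qed
  have diag: "B $$ (i, i) = 0" if "i < 4 * r" for i
    using BDij[of i i] d2(1)[OF that] that by (auto simp: mult_ac)
  have last: "B $$ (?l, j) = 0" if "j < 4 * r" for j
    using BDij[of ?l j] d2(2)[OF that] that by (simp add: d_def[of "4 * r"])
  define b where "b = B $$ (?l, ?l)"
  have Bz: "(B *\<^sub>v z) $ ?l = b * z $ ?l" if "z \<in> carrier_vec ?n" for z
    using that Bc last by (simp add: scalar_prod_def atLeast0LessThan b_def)
  have bb: "b * b = 1"
    using arg_cong[OF B(2), of "\<lambda>M. M $$ (?l, ?l)"] Bc last
    by (simp add: scalar_prod_def atLeast0LessThan b_def)
  have bw: "b * w $ ?l + w $ ?l = 0"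
    using arg_cong[OF w(2), of "\<lambda>v. v $ ?l"] Bz[OF w(1)] w(1) Bc by simp
  have BDz: "((B * ?D) *\<^sub>v z) $ ?l = b * z $ ?l" if z: "z \<in> carrier_vec ?n" for z
  proof -
    have "(B * ?D) *\<^sub>v z = B *\<^sub>v (?D *\<^sub>v z)"
      using Bc z by (intro assoc_mult_mat_vec[of _ ?n ?n _ ?n]) auto
    then show ?thesis using z by (subst (asm) mat_diag_mult_vec) (auto simp: Bz d_def)
  qed
  have Bvw: "B *\<^sub>v ?v + w \<in> carrier_vec ?n" using Bc vc w(1) by simp
  have vl: "?v $ ?l = c" by (simp add: last_coord_vec_def)
  have "b * (b * c + w $ ?l) + (b * c + w $ ?l) = 0"
    using arg_cong[OF Bv, of "\<lambda>v. v $ ?l"] BDz[OF Bvw] Bz[OF vc] w(1) Bc vc Bvw vl by simp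
  \<comment> \<open>The terms in \<open>w\<close> are grouped so that \<open>bw\<close> cancels
    them: the translation part of the involution cannot help.\<close>
  then have "(b * b) * c + b * c + (b * w $ ?l + w $ ?l) = 0" by (simp add: algebra_simps)
  then have "(1 + b) * c = 0" unfolding bb bw by (simp add: algebra_simps)
  then have "b = -1" using c by (simp add: add_eq_0_iff)
  moreover have "(\<Sum>i<?n. B $$ (i, i)) = b" using diag by (simp add: b_def)
  ultimately have "(\<Sum>i<?n. B $$ (i, i)) = of_int (int ?n - 2 * int (2 * r + 1))" by simp
  then have "det B = (-1) ^ (2 * r + 1)"
    using B by (intro unitary_involution_det[of B ?n]) (auto simp: carrier_SU_iff)
  then show False using B(1) by (simp add: carrier_SU_iff)
qed

lemma paired_rotation_mat_of_values:
  assumes len: "length zs = 2 * r" and zs: "\<And>z. z \<in> set zs \<Longrightarrow> cmod z = 1 \<and> Im z > 0"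
  obtains \<theta> where "\<And>k. k \<in> {1..2 * r} \<Longrightarrow> \<theta> k \<in> {0<..<pi}"
    "mat_diag (4 * r + 1) (paired_values zs 0) = paired_rotation_mat r \<theta>"
proof -
  \<comment> \<open>A point of the open upper half circle is determined by its real part, so
    \<open>arccos\<close> recovers its angle. Angles are counted from 1, list positions from
    0.\<close>
  define \<theta> where "\<theta> k = arccos (Re (zs ! (k - 1)))" for k
  have *: "\<theta> (Suc j) \<in> {0<..<pi} \<and> cis (\<theta> (Suc j)) = zs ! j" if "j < 2 * r" for j
  proof -
    define z where "z = zs ! j"
    have z: "cmod z = 1" "Im z > 0" using zs[of z] that len by (auto simp: z_def)
    then have sq: "(Re z)\<^sup>2 + (Im z)\<^sup>2 = 1" by (metis cmod_power2 one_power2)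
    then have "(Re z)\<^sup>2 < 1" using z(2) by (smt (verit) zero_less_power)
    then have R: "-1 < Re z" "Re z < 1" by (auto simp: abs_square_less_1)
    have "sin (arccos (Re z)) = sqrt (1 - (Re z)\<^sup>2)" using R by (intro sin_arccos) auto
    also have "1 - (Re z)\<^sup>2 = (Im z)\<^sup>2" using sq by simp
    finally have "cis (arccos (Re z)) = z" using R z(2) by (simp add: complex_eq_iff)
    then show ?thesis using arccos_lt_bounded[OF R] by (simp add: \<theta>_def z_def)
  qed
  have "\<theta> k \<in> {0<..<pi}" if "k \<in> {1..2 * r}" for k
    using *[of "k - 1"] that by (cases k) auto
  moreover have "mat_diag (4 * r + 1) (paired_values zs 0) = paired_rotation_mat r \<theta>"
    unfolding paired_rotation_mat_def mat_diag_eq_iff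
  proof (intro allI impI)
    fix i assume "i < 4 * r + 1"
    then show "paired_values zs 0 i = (if i = 4 * r then 1 else if even i then cis (\<theta> (i div 2 + 1))
        else cis (- \<theta> (i div 2 + 1)))"
      using *[of "i div 2"] len by (auto simp: paired_values_def cis_cnj[symmetric])
  qed
  ultimately show ?thesis by (rule that)
qed

theorem corollary1p9:
  fixes n :: nat and g :: "complex mat \<times> complex vec"
  assumes "n \<ge> 1" and "g \<in> carrier (SU_affine n)"
  shows "strongly_reversible (SU_affine n) g \<longleftrightarrow>
    strongly_reversible (SU n) (fst g) \<and>
    \<not> (\<exists>(r :: nat) (\<theta> :: nat \<Rightarrow> real) (v1 :: complex).
         n = 4 * r + 1 \<and> v1 \<noteq> 0 \<and> (\<forall>k \<in> {1..2 * r}. \<theta> k \<in> {0<..<pi}) \<and>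
         conjugate_in (SU_affine n) g (paired_rotation_mat r \<theta>, last_coord_vec r v1))"
    (is "_ \<longleftrightarrow> _ \<and> \<not> ?exceptional")
proof -
  interpret S: group "SU n" by (rule group_SU)
  interpret T: group "SU_affine n" by (rule group_SU_affine)
  obtain A v where g: "g = (A, v)" and A: "A \<in> carrier (SU n)" and v: "v \<in> carrier_vec n"
    using assms(2) by auto
  show ?thesis
  proof (intro iffI conjI)
    assume sr: "strongly_reversible (SU_affine n) g"
    then show "strongly_reversible (SU n) (fst g)"
      using A v by (auto simp: g strongly_reversible_SU_affine_iff strongly_reversible_SU_iff)
    show "\<not> ?exceptional"
    proof
      assume ?exceptional
      then obtain r \<theta> v1 where n: "n = 4 * r + 1" and v1: "v1 \<noteq> 0"
        and \<theta>: "\<And>k. k \<in> {1..2 * r} \<Longrightarrow> \<theta> k \<in> {0<..<pi}"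
        and conj: "conjugate_in (SU_affine n) g (paired_rotation_mat r \<theta>, last_coord_vec r v1)"
        by blast
      have "paired_rotation_mat r \<theta> \<in> carrier (SU n)"
        using T.conjugate_in_closed[OF conj assms(2)] by simp
      with not_reversible_exceptional[of r \<theta>, OF \<theta> v1] T.strongly_reversible_conjugate[OF conj assms(2) sr]
      show False unfolding n by blast
    qed
  next
    assume asm: "strongly_reversible (SU n) (fst g) \<and> \<not> ?exceptional"
    then have srA: "strongly_reversible (SU n) A" by (simp add: g)
    then obtain B0 where B0: "B0 \<in> carrier (SU n)" "B0 * B0 = 1\<^sub>m n" "B0 * A * (B0 * A) = 1\<^sub>m n"
      using strongly_reversible_SU_iff[OF A] by blast
    have "A \<in> unitary_mats n" using A by (simp add: carrier_SU_iff)
    then obtain as where as: "length as = n" "char_poly A = (\<Prod>a\<leftarrow>as. [:- a, 1:])"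
      "mset (map cnj as) = mset as" "\<And>a. a \<in> set as \<Longrightarrow> cmod a = 1"
      using spectrum_of_reversible[OF _ carrier_SU_mat[OF B0(1)] B0(2,3)] by metis
    obtain zs a m where len: "n = 2 * length zs + a + m"
      and zs: "\<And>z. z \<in> set zs \<Longrightarrow> cmod z = 1 \<and> Im z > 0"
      and cp: "char_poly A = (\<Prod>i<n. [:- paired_values zs a i, 1:])"
      using conj_closed_order[OF as(3,4)] as(1,2) by metis
    define d where "d = paired_values zs a"
    obtain w where D: "mat_diag n d \<in> carrier (SU n)" and w: "w \<in> carrier_vec n"
      "\<And>i. i < n \<Longrightarrow> d i \<noteq> 1 \<Longrightarrow> w $ i = 0"
      and gw: "conjugate_in (SU_affine n) g (mat_diag n d, w)"
      using conjugate_to_diagonal[OF A v assms(1) cp] unfolding g d_def by metis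
    \<comment> \<open>Conjugacy is symmetric, so it suffices to reverse a normal form of
      \<open>g\<close>.\<close>
    have *: "strongly_reversible (SU_affine n) g"
      if "conjugate_in (SU_affine n) g h" "strongly_reversible (SU_affine n) h" for h
      using that T.conjugate_in_sym[OF that(1) assms(2)] T.conjugate_in_closed[OF that(1) assms(2)]
        T.strongly_reversible_conjugate by blast
    show "strongly_reversible (SU_affine n) g"
    proof (cases "w = 0\<^sub>v n")
      case True
      \<comment> \<open>Without a translation, an involution that reverses the linear part also
        reverses the affine map. Linear reversibility is carried over from \<open>A\<close> to the
        diagonal matrix.\<close>
      have "strongly_reversible (SU n) (mat_diag n d)"
        using conjugate_in_SU_linear_part[OF A v D w(1)] gw A srA S.strongly_reversible_conjugate
        unfolding g by blast
      then obtain B where B: "B \<in> carrier (SU n)" "B * B = 1\<^sub>m n"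
        "B * mat_diag n d * (B * mat_diag n d) = 1\<^sub>m n"
        using strongly_reversible_SU_iff[OF D] by blast
      then have "strongly_reversible (SU_affine n) (mat_diag n d, w)"
        unfolding strongly_reversible_SU_affine_iff[OF D w(1)]
        using carrier_SU_mat[OF B(1)] True
        by (intro bexI[of _ B] bexI[of _ "0\<^sub>v n"]) (auto simp: mult_mat_zero_vec[of _ n n])
      then show ?thesis using gw by (rule *[rotated])
    next
      case False
      then obtain i where i: "i < n" "w $ i \<noteq> 0" using w(1) by (auto simp: vec_eq_iff)
      then have di: "d i = 1" using w(2) by blast
      \<comment> \<open>Were \<open>m\<close> zero, every diagonal value would be -1 or nonreal,
        against \<open>di\<close>.\<close>
      have "m \<noteq> 0"
      proof
        assume "m = 0"
        have "i div 2 < length zs" if "i < 2 * length zs" using that by simp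
        then have "Im (zs ! (i div 2)) > 0" if "i < 2 * length zs" using that zs nth_mem by blast
        with di i(1) len \<open>m = 0\<close> show False
          by (auto simp: d_def paired_values_def complex_eq_iff split: if_splits)
      qed
      \<comment> \<open>One eigenvalue 1 is reserved for the last coordinate, which will carry the
        translation; \<open>m'\<close> counts the others.\<close>
      then obtain m' where m: "m = Suc m'" by (cases m) auto
      define l where "l = n - 1"
      have nl: "n = Suc l" using assms(1) by (simp add: l_def)
      have "d l = 1" using len m by (simp add: l_def d_def paired_values_def)
      then obtain c where c: "c \<noteq> 0" and
        "conjugate_in (SU_affine n) (mat_diag n d, w) (mat_diag n d, c \<cdot>\<^sub>v unit_vec n l)"
        using conjugate_to_last_coordinate[of l d w] D w False unfolding nl by metis
      then have gc: "conjugate_in (SU_affine n) g (mat_diag n d, c \<cdot>\<^sub>v unit_vec n l)"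
        using T.conjugate_in_trans[OF gw _ assms(2)] by blast
      show ?thesis
      proof (cases "a + m' \<ge> 1 \<or> odd (length zs)")
        case True
        then obtain B where B: "B \<in> carrier (SU n)" "B * B = 1\<^sub>m n"
          "B * mat_diag n d * (B * mat_diag n d) = 1\<^sub>m n"
          "B *\<^sub>v unit_vec n l = - unit_vec n l"
          using paired_reversing_involution[of zs a m'] zs len
          unfolding d_def l_def m by metis
        define u where "u = c \<cdot>\<^sub>v (unit_vec n l :: complex vec)"
        have u: "u \<in> carrier_vec n" by (simp add: u_def)
        note cB = carrier_SU_mat[OF B(1)]
        have Bu: "B *\<^sub>v u = - u"
          unfolding u_def using cB B(4) by (subst mult_mat_vec[of _ n n]) auto
        \<comment> \<open>The diagonal matrix fixes \<open>u\<close> and \<open>B\<close> negates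
          it, so their product maps \<open>- u\<close> to \<open>u\<close>, and the involution with
          linear part \<open>B\<close> and no translation reverses the normal form.\<close>
        have "mat_diag n d *\<^sub>v (- u) = - u"
          using u \<open>d l = 1\<close> by (subst mat_diag_mult_vec) (auto simp: u_def unit_vec_def)
        then have "(B * mat_diag n d) *\<^sub>v (- u) = B *\<^sub>v (- u)"
          using cB u by (subst assoc_mult_mat_vec[of _ n n _ n]) auto
        also have "\<dots> = B *\<^sub>v (B *\<^sub>v u)" unfolding Bu ..
        also have "\<dots> = u" using cB u B(2) by (subst assoc_mult_mat_vec[of _ n n _ n, symmetric]) auto
        finally have "(B * mat_diag n d) *\<^sub>v (B *\<^sub>v u + 0\<^sub>v n) + (B *\<^sub>v u + 0\<^sub>v n) = 0\<^sub>v n"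
          using u unfolding Bu by simp
        then have "strongly_reversible (SU_affine n) (mat_diag n d, u)"
          unfolding strongly_reversible_SU_affine_iff[OF D u]
          using B cB by (intro bexI[of _ B] bexI[of _ "0\<^sub>v n"]) auto
        then show ?thesis using gc unfolding u_def by (rule *[rotated])
      next
        case False
        \<comment> \<open>What remains is an even number of pairs, no eigenvalue -1 and a single
          eigenvalue 1: the excluded normal form.\<close>
        then obtain r where r: "length zs = 2 * r" by (auto elim: evenE)
        have a: "a = 0" and n: "n = 4 * r + 1" using False len m r by auto
        obtain \<theta> where \<theta>: "\<And>k. k \<in> {1..2 * r} \<Longrightarrow> \<theta> k \<in> {0<..<pi}"
          and D\<theta>: "mat_diag n d = paired_rotation_mat r \<theta>"
          using paired_rotation_mat_of_values[OF r zs] unfolding d_def a n by metis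
        have "c \<cdot>\<^sub>v unit_vec n l = last_coord_vec r c"
          by (rule eq_vecI) (auto simp: last_coord_vec_def l_def n unit_vec_def)
        with gc D\<theta> have "conjugate_in (SU_affine n) g (paired_rotation_mat r \<theta>, last_coord_vec r c)"
          by simp
        with \<theta> n c have ?exceptional by blast
        with asm show ?thesis by blast
      qed
    qed
  qed
qed

end
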